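(* Let $k$ be a field with algebraic closure $\bar k$, and let $\chi$ be a non-constant invariant of closed (connected) orientable surfaces with values in $k$, i.e. a non-constant sequence $\chi(\Sigma_g)\in k$, $g\ge 0$, where $\Sigma_g$ is the closed orientable surface of genus $g$. Then $\chi$ is almost-quantizable through a $k\text{-}\mathbf{Vect}_0$-valued almost-TQFT if and only if there exist $N\ge 1$, a partition $(m_1,\ldots,m_s)$ of $N$, coefficients $\lambda_1,\ldots,\lambda_s\in\bar k$, and values $a_{i,j}\in\bar k$ for $1\le i\le s$ and $0\le j\le m_i-1$, such that for all $g\ge\max(m_1,\ldots,m_s)$ $$\chi(\Sigma_g)=\sum_{i=1}^s\sum_{j=0}^{m_i-1}a_{i,j}\binom{g}{j}\lambda_i^{g-j}.$$
   Context: $k\text{-}\mathbf{Vect}_0$ is the category of finite dimensional $k$-vector spaces. $\mathbf{Bd}_{1+1}$ is the symmetric monoidal category whose objects are closed (possibly empty) orientable smooth $1$-manifolds; a morphism $M_1\to M_2$ is a class of compact orientable smooth surfaces $W$ with $\partial W=M_1\sqcup M_2$, up to boundary-preserving diffeomorphism; composition is gluing; the monoidal structure is disjoint union. $\mathbf{Tb}_{1+1}$ is the subcategory with the same objects whose morphisms are those bordisms $W$ that are disjoint unions $W=\sqcup_i W_i$ of connected bordisms $W_i$ each having connected (possibly empty) in and out boundaries. A $k\text{-}\mathbf{Vect}_0$-valued almost-TQFT is a symmetric monoidal functor $Z:\mathbf{Tb}_{1+1}\to k\text{-}\mathbf{Vect}_0$. The invariant $\chi$ is almost-quantizable through a $k\text{-}\mathbf{Vect}_0$-valued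 almost-TQFT if there is such a $Z$ with $Z(\Sigma_g)(1)=\chi(\Sigma_g)$ for all $g\ge 0$, where $\Sigma_g$ is seen as a bordism $\emptyset\to\emptyset$. (Equivalently: there exist a finite dimensional $k$-vector space $V$, a vector $v_0\in V$, an endomorphism $\tilde T$ of $V$ and a linear functional $\tilde\eta$ on $V$ with $\chi(\Sigma_g)=\tilde\eta(\tilde T^gv_0)$ for all $g\ge 0$.) *)

theory Defs
  imports
    "HOL-Algebra.Algebraic_Closure_Type"
    "HOL-Library.Function_Algebras"
    "HOL-Library.Multiset"
begin

section \<open>The tube category\<close>

text \<open>
  A closed \<open>1\<close>-manifold is, up to diffeomorphism, a disjoint union of \<open>n\<close> circles, labelled
  \<open>0, \<dots>, n - 1\<close>; we take the natural numbers \<open>n\<close> as objects. By the classification of compact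
  orientable surfaces, a connected bordism whose in-boundary and out-boundary are both connected
  or empty is determined, up to diffeomorphism preserving the boundary circles, by its genus
  and by the circle (\<open>None\<close> if empty) that forms each of its two boundaries.
\<close>

datatype component =
  Component (in_circle: "nat option") (out_circle: "nat option") (genus: nat)

type_synonym bordism = "component multiset"

definition in_circles :: "bordism \<Rightarrow> nat multiset" where
  "in_circles W = {# the (in_circle c). c \<in># filter_mset (\<lambda>c. in_circle c \<noteq> None) W #}"

definition out_circles :: "bordism \<Rightarrow> nat multiset" where
  "out_circles W = {# the (out_circle c). c \<in># filter_mset (\<lambda>c. out_circle c \<noteq> None) W #}"

text \<open>The morphisms from \<open>n\<close> circles to \<open>m\<close> circles: every circle bounds exactly one component.\<close>

definition Tb :: "nat \<Rightarrow> nat \<Rightarrow> bordism set" where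
  "Tb n m = {W. in_circles W = mset_set {..<n} \<and> out_circles W = mset_set {..<m}}"

definition tb_id :: "nat \<Rightarrow> bordism" where
  "tb_id n = {# Component (Some i) (Some i) 0. i \<in># mset_set {..<n} #}"

text \<open>
  Gluing the out-boundary of \<open>W\<close> to the in-boundary of \<open>W'\<close> (diagrammatic order). Components of
  \<open>W\<close> without out-boundary and components of \<open>W'\<close> without in-boundary are not glued to anything;
  two components that are glued meet in a single circle, so their genera add up.
\<close>

definition tb_comp :: "bordism \<Rightarrow> bordism \<Rightarrow> bordism" where
  "tb_comp W W' =
     filter_mset (\<lambda>c. out_circle c = None) W + filter_mset (\<lambda>c. in_circle c = None) W' +
     (\<Sum>c\<in>#W. \<Sum>c'\<in>#W'.
        if out_circle c \<noteq> None \<and> out_circle c = in_circle c'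
        then {# Component (in_circle c) (out_circle c') (genus c + genus c') #} else {#})"

text \<open>Disjoint union of \<open>W \<in> Tb n m\<close> with \<open>W'\<close>: the circles of \<open>W'\<close> come after those of \<open>W\<close>.\<close>

definition tb_disj :: "nat \<Rightarrow> nat \<Rightarrow> bordism \<Rightarrow> bordism \<Rightarrow> bordism" where
  "tb_disj n m W W' =
     W + {# Component (map_option (\<lambda>i. n + i) (in_circle c))
              (map_option (\<lambda>j. m + j) (out_circle c)) (genus c). c \<in># W' #}"

definition tb_swap :: "nat \<Rightarrow> nat \<Rightarrow> bordism" where
  "tb_swap m n =
     {# Component (Some i) (Some (n + i)) 0. i \<in># mset_set {..<m} #} +
     {# Component (Some (m + i)) (Some i) 0. i \<in># mset_set {..<n} #}"

definition closed_surface :: "nat \<Rightarrow> bordism" where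
  "closed_surface g = {# Component None None g #}"


section \<open>Finite-dimensional vector spaces\<close>

text \<open>
  The finite-dimensional spaces over the field \<open>'k\<close> are taken to be the finite-dimensional
  subspaces of the space of sequences in \<open>'k\<close>; every finite-dimensional space is isomorphic to
  one of these.
\<close>

definition seq_scale :: "'k::field \<Rightarrow> (nat \<Rightarrow> 'k) \<Rightarrow> nat \<Rightarrow> 'k" where
  "seq_scale c x = (\<lambda>i. c * x i)"

interpretation seq: vector_space "seq_scale :: 'k::field \<Rightarrow> (nat \<Rightarrow> 'k) \<Rightarrow> nat \<Rightarrow> 'k"
  by standard (auto simp: seq_scale_def fun_eq_iff algebra_simps)

definition fd_space :: "(nat \<Rightarrow> 'k::field) set \<Rightarrow> bool" where
  "fd_space V \<longleftrightarrow> (\<exists>B. finite B \<and> V = seq.span B)"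

text \<open>Maps between subspaces are functions whose values outside the domain are irrelevant.\<close>

definition linear_map ::
  "(nat \<Rightarrow> 'k::field) set \<Rightarrow> (nat \<Rightarrow> 'k) set \<Rightarrow> ((nat \<Rightarrow> 'k) \<Rightarrow> (nat \<Rightarrow> 'k)) \<Rightarrow> bool" where
  "linear_map V W f \<longleftrightarrow>
     (\<forall>x\<in>V. f x \<in> W) \<and>
     (\<forall>x\<in>V. \<forall>y\<in>V. f (x + y) = f x + f y) \<and>
     (\<forall>c. \<forall>x\<in>V. f (seq_scale c x) = seq_scale c (f x))"

definition bilinear_map ::
  "(nat \<Rightarrow> 'k::field) set \<Rightarrow> (nat \<Rightarrow> 'k) set \<Rightarrow> (nat \<Rightarrow> 'k) set \<Rightarrow>
   ((nat \<Rightarrow> 'k) \<Rightarrow> (nat \<Rightarrow> 'k) \<Rightarrow> (nat \<Rightarrow> 'k)) \<Rightarrow> bool" where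
  "bilinear_map V W U \<beta> \<longleftrightarrow>
     (\<forall>x\<in>V. linear_map W U (\<beta> x)) \<and> (\<forall>y\<in>W. linear_map V U (\<lambda>x. \<beta> x y))"

text \<open>\<open>\<beta>\<close> exhibits \<open>P\<close> as the tensor product of \<open>V\<close> and \<open>W\<close>.\<close>

definition is_tensor_product ::
  "(nat \<Rightarrow> 'k::field) set \<Rightarrow> (nat \<Rightarrow> 'k) set \<Rightarrow> (nat \<Rightarrow> 'k) set \<Rightarrow>
   ((nat \<Rightarrow> 'k) \<Rightarrow> (nat \<Rightarrow> 'k) \<Rightarrow> (nat \<Rightarrow> 'k)) \<Rightarrow> bool" where
  "is_tensor_product V W P \<beta> \<longleftrightarrow>
     bilinear_map V W P \<beta> \<and>
     (\<forall>U \<gamma>. fd_space U \<and> bilinear_map V W U \<gamma> \<longrightarrow>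
        (\<exists>f. linear_map P U f \<and> (\<forall>x\<in>V. \<forall>y\<in>W. f (\<beta> x y) = \<gamma> x y)) \<and>
        (\<forall>f f'. linear_map P U f \<and> (\<forall>x\<in>V. \<forall>y\<in>W. f (\<beta> x y) = \<gamma> x y) \<and>
                linear_map P U f' \<and> (\<forall>x\<in>V. \<forall>y\<in>W. f' (\<beta> x y) = \<gamma> x y) \<longrightarrow>
                (\<forall>p\<in>P. f p = f' p)))"


section \<open>Almost-TQFTs\<close>

text \<open>
  A symmetric (strong) monoidal functor from the tube category to finite-dimensional spaces.
  The structure isomorphism from the tensor product of \<open>Z0 m\<close> and \<open>Z0 n\<close> to \<open>Z0 (m + n)\<close> is given
  by the corresponding universal bilinear map \<open>\<mu> m n\<close>, and the one from \<open>'k\<close> to \<open>Z0 0\<close> by the image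
  \<open>u\<close> of \<open>1\<close>. Disjoint union is strictly associative and unital on the labelled circles, so the
  coherence axioms mention no associator or unitor on the source side.
\<close>

locale almost_TQFT =
  fixes Z0 :: "nat \<Rightarrow> (nat \<Rightarrow> 'k::field) set"
    and Z :: "bordism \<Rightarrow> (nat \<Rightarrow> 'k) \<Rightarrow> (nat \<Rightarrow> 'k)"
    and \<mu> :: "nat \<Rightarrow> nat \<Rightarrow> (nat \<Rightarrow> 'k) \<Rightarrow> (nat \<Rightarrow> 'k) \<Rightarrow> (nat \<Rightarrow> 'k)"
    and u :: "nat \<Rightarrow> 'k"
  assumes Z_obj: "fd_space (Z0 n)"
    and Z_mor: "W \<in> Tb n m \<Longrightarrow> linear_map (Z0 n) (Z0 m) (Z W)"
    and Z_id: "x \<in> Z0 n \<Longrightarrow> Z (tb_id n) x = x"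
    and Z_comp: "\<lbrakk>W \<in> Tb n m; W' \<in> Tb m l; x \<in> Z0 n\<rbrakk> \<Longrightarrow> Z (tb_comp W W') x = Z W' (Z W x)"
    and mu_tensor: "is_tensor_product (Z0 m) (Z0 n) (Z0 (m + n)) (\<mu> m n)"
    and unit_iso: "u \<noteq> 0" "Z0 0 = seq.span {u}"
    and mu_natural: "\<lbrakk>W \<in> Tb n m; W' \<in> Tb n' m'; x \<in> Z0 n; y \<in> Z0 n'\<rbrakk> \<Longrightarrow>
      Z (tb_disj n m W W') (\<mu> n n' x y) = \<mu> m m' (Z W x) (Z W' y)"
    and mu_assoc: "\<lbrakk>x \<in> Z0 l; y \<in> Z0 m; z \<in> Z0 n\<rbrakk> \<Longrightarrow>
      \<mu> (l + m) n (\<mu> l m x y) z = \<mu> l (m + n) x (\<mu> m n y z)"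
    and mu_unit_left: "x \<in> Z0 n \<Longrightarrow> \<mu> 0 n u x = x"
    and mu_unit_right: "x \<in> Z0 n \<Longrightarrow> \<mu> n 0 x u = x"
    and mu_sym: "\<lbrakk>x \<in> Z0 m; y \<in> Z0 n\<rbrakk> \<Longrightarrow> Z (tb_swap m n) (\<mu> m n x y) = \<mu> n m y x"

text \<open>
  An invariant of closed connected orientable surfaces is given by its value \<open>\<chi> g\<close> in each genus
  \<open>g\<close>. Under the identification of \<open>Z0 0\<close> with \<open>'k\<close>, the number \<open>Z (closed_surface g) 1\<close> is the
  coefficient of \<open>Z (closed_surface g) u\<close> with respect to \<open>u\<close>.
\<close>

definition almost_quantizable :: "(nat \<Rightarrow> 'k::field) \<Rightarrow> bool" where
  "almost_quantizable \<chi> \<longleftrightarrow>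
     (\<exists>Z0 Z \<mu> u. almost_TQFT Z0 Z \<mu> u \<and> (\<forall>g. Z (closed_surface g) u = seq_scale (\<chi> g) u))"


section \<open>Partitions\<close>

definition is_partition :: "nat \<Rightarrow> nat list \<Rightarrow> bool" where
  "is_partition N ms \<longleftrightarrow> sum_list ms = N \<and> (\<forall>m\<in>set ms. m \<ge> 1) \<and> sorted_wrt (\<ge>) ms"

end

theory Submission
  imports Defs
begin

text \<open>
  Both sides of the equivalence say that \<open>\<chi>\<close> satisfies a linear recurrence with constant coefficients
  (\<open>C_recurrent\<close>).

  An almost-TQFT sends the disc with \<open>g\<close> handles to a vector \<open>v g\<close> of the finite-dimensional space of
  one circle, and tubes shift the index \<open>g\<close>. A linear dependence of some \<open>v d\<close> on the earlier vectors
  is therefore a recurrence that all shifts satisfy, and closing the disc by a cap gives the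
  recurrence for \<open>\<chi>\<close> (\<open>C_recurrent_if_almost_quantizable\<close>). Conversely, a recurrence of order \<open>d\<close> is
  the iteration of its companion matrix, started at the initial state of \<open>\<chi>\<close> and read off at the first
  coordinate. Such a vector, matrix and covector extend to a strict monoidal functor on the tube
  category: \<open>n\<close> circles go to the space with basis the \<open>d\<close>-colourings of the circles, and the matrix
  entry of a bordism is the product of the entries of its components. Composition is respected because
  every circle bounds exactly one component, so that the sum over the colourings of the glued circles
  splits into one matrix product for each circle (\<open>tube_weights.almost_TQFT_mor\<close>,
  \<open>almost_quantizable_if_C_recurrent\<close>).

  Over an algebraically closed field the characteristic polynomial of a recurrence splits, and the
  solutions are spanned by the sequences \<open>of_nat (g choose j) * l ^ (g - j)\<close>, where \<open>l\<close> is a root and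
  \<open>j\<close> is below its multiplicity. Conversely, a sequence that has this form from some index on satisfies
  a recurrence; a power of the shift operator disposes of the exceptional values
  (\<open>C_recurrent_iff_jordan_sum\<close>). Finally, a sequence in \<open>'k\<close> that satisfies a recurrence over the
  algebraic closure also satisfies one over \<open>'k\<close>: apply a \<open>'k\<close>-linear retraction of the closure onto
  \<open>'k\<close> to the coefficients (\<open>C_recurrent_to_ac_iff\<close>).
\<close>


section \<open>Polynomials in the shift operator\<close>

text \<open>
  With \<open>E\<close> for the shift of sequences, this is the operator \<open>p(E)\<close>. Sequences become a module over
  the polynomial ring, and a linear recurrence says that a monic polynomial kills the sequence.
\<close>

definition poly_shift :: "'a::comm_ring_1 poly \<Rightarrow> (nat \<Rightarrow> 'a) \<Rightarrow> nat \<Rightarrow> 'a" where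
  "poly_shift p s n = (\<Sum>i\<le>Polynomial.degree p. Polynomial.coeff p i * s (n + i))"

text \<open>
  Summing up to a common bound puts polynomials of different degrees on an equal footing.
\<close>

lemma poly_shift_altdef:
  assumes "Polynomial.degree p \<le> N"
  shows "poly_shift p s n = (\<Sum>i\<le>N. Polynomial.coeff p i * s (n + i))"
  unfolding poly_shift_def
  by (rule sum.mono_neutral_left) (use assms in \<open>auto simp: Polynomial.coeff_eq_0\<close>)

lemma poly_shift_0 [simp]: "poly_shift 0 s = (\<lambda>n. 0)"
  by (simp add: poly_shift_def fun_eq_iff)

lemma poly_shift_pCons: "poly_shift (pCons a p) s n = a * s n + poly_shift p s (Suc n)"
proof -
  have "poly_shift (pCons a p) s n = (\<Sum>i\<le>Suc (Polynomial.degree p). Polynomial.coeff (pCons a p) i * s (n + i))"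
    by (rule poly_shift_altdef) (simp add: degree_pCons_le)
  also have "\<dots> = a * s n + (\<Sum>i\<le>Polynomial.degree p. Polynomial.coeff p i * s (n + Suc i))"
    by (subst sum.atMost_Suc_shift) simp
  finally show ?thesis by (simp add: poly_shift_def)
qed

lemma poly_shift_add: "poly_shift (p + q) s n = poly_shift p s n + poly_shift q s n"
proof -
  let ?N = "max (Polynomial.degree p) (Polynomial.degree q)"
  have "poly_shift (p + q) s n = (\<Sum>i\<le>?N. Polynomial.coeff (p + q) i * s (n + i))"
    by (rule poly_shift_altdef) (rule degree_add_le_max)
  then show ?thesis
    by (simp add: poly_shift_altdef[of p ?N] poly_shift_altdef[of q ?N] sum.distrib algebra_simps)
qed

lemma poly_shift_smult: "poly_shift (Polynomial.smult c p) s n = c * poly_shift p s n"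
  by (induction p arbitrary: n) (simp_all add: poly_shift_pCons algebra_simps)

lemma poly_shift_mult: "poly_shift (p * q) s = poly_shift p (poly_shift q s)"
proof (induction p)
  case (pCons a p)
  have "poly_shift (pCons a p * q) s n = poly_shift (pCons a p) (poly_shift q s) n" for n
    by (simp add: mult_pCons_left poly_shift_add poly_shift_smult poly_shift_pCons pCons.IH)
  then show ?case by blast
qed simp

lemma poly_shift_zero_seq [simp]: "poly_shift p (\<lambda>n. 0) = (\<lambda>n. 0)"
  by (simp add: poly_shift_def fun_eq_iff)

lemma poly_shift_sum: "poly_shift p (\<lambda>n. \<Sum>i\<in>I. c i * f i n) m = (\<Sum>i\<in>I. c i * poly_shift p (f i) m)"
  unfolding poly_shift_def
  by (simp add: sum_distrib_left sum.swap[of _ I] mult_ac)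

lemma poly_shift_linear_factor: "poly_shift [:- l, 1:] s n = s (Suc n) - l * s n"
  by (simp add: poly_shift_pCons)

lemma poly_shift_dvd_zero:
  assumes "p dvd q" "poly_shift p s = (\<lambda>n. 0)"
  shows "poly_shift q s = (\<lambda>n. 0)"
proof -
  from assms(1) obtain r where "q = r * p" by (metis dvd_def mult.commute)
  with assms(2) show ?thesis by (simp add: poly_shift_mult)
qed

lemma poly_shift_monom: "poly_shift (Polynomial.monom 1 M) s n = s (n + M)"
  by (simp add: poly_shift_altdef[of _ M] degree_monom_le if_distrib if_distribR eq_commute cong: if_cong)

section \<open>Jordan sequences\<close>

text \<open>
  The binomial entry of the \<open>g\<close>-th power of a Jordan block with eigenvalue \<open>l\<close>, at distance \<open>j\<close>
  from the diagonal. The truncated exponent does no harm: for \<open>g < j\<close> the binomial coefficient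
  vanishes, so the formula is right for every \<open>g\<close>. For \<open>l = 0\<close> it is the indicator of \<open>g = j\<close>,
  because \<open>0 ^ 0 = 1\<close>; nilpotent blocks are therefore covered as well.
\<close>

definition jordan_seq :: "'a::comm_ring_1 \<Rightarrow> nat \<Rightarrow> nat \<Rightarrow> 'a" where
  "jordan_seq l j g = of_nat (g choose j) * l ^ (g - j)"

lemma jordan_seq_Suc_0: "jordan_seq l 0 (Suc g) = l * jordan_seq l 0 g"
  by (simp add: jordan_seq_def)

text \<open>
  Pascal's rule: \<open>E - l\<close> sends the \<open>j + 1\<close>-st sequence of a block to the \<open>j\<close>-th. In contrast to
  polynomials in \<open>g\<close> times powers of \<open>l\<close>, this works in every characteristic.
\<close>

lemma jordan_seq_Suc_Suc:
  "jordan_seq l (Suc j) (Suc g) = l * jordan_seq l (Suc j) g + jordan_seq l j g"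
proof (cases "Suc j \<le> g")
  case True
  then have "g - j = Suc (g - Suc j)" by simp
  then show ?thesis by (simp add: jordan_seq_def algebra_simps)
next
  case False
  then show ?thesis by (simp add: jordan_seq_def binomial_eq_0 not_le)
qed

lemma poly_shift_jordan_seq: "poly_shift ([:- l, 1:] ^ Suc j) (jordan_seq l j) = (\<lambda>n. 0)"
proof (induction j)
  case 0
  show ?case by (simp add: fun_eq_iff poly_shift_linear_factor jordan_seq_Suc_0)
next
  case (Suc j)
  have "poly_shift [:- l, 1:] (jordan_seq l (Suc j)) = jordan_seq l j"
    by (simp add: fun_eq_iff poly_shift_linear_factor jordan_seq_Suc_Suc)
  then have "poly_shift ([:- l, 1:] ^ Suc j * [:- l, 1:]) (jordan_seq l (Suc j)) = (\<lambda>n. 0)"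
    using Suc.IH by (simp only: poly_shift_mult)
  then show ?case by (simp only: power_Suc2)
qed

definition jordan_span :: "'a::comm_ring_1 multiset \<Rightarrow> (nat \<Rightarrow> 'a) set" where
  "jordan_span A = {s. \<exists>a. \<forall>g. s g = (\<Sum>l\<in>set_mset A. \<Sum>j<count A l. a l j * jordan_seq l j g)}"

lemma jordan_span_add:
  assumes "s \<in> jordan_span A" "t \<in> jordan_span A"
  shows "(\<lambda>g. s g + t g) \<in> jordan_span A"
proof -
  from assms obtain a b where
    "\<forall>g. s g = (\<Sum>l\<in>set_mset A. \<Sum>j<count A l. a l j * jordan_seq l j g)"
    "\<forall>g. t g = (\<Sum>l\<in>set_mset A. \<Sum>j<count A l. b l j * jordan_seq l j g)"
    unfolding jordan_span_def by blast
  then show ?thesis unfolding jordan_span_def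
    by (auto intro!: exI[of _ "\<lambda>l j. a l j + b l j"] simp: sum.distrib ring_distribs)
qed

lemma jordan_span_scale:
  assumes "s \<in> jordan_span A"
  shows "(\<lambda>g. c * s g) \<in> jordan_span A"
proof -
  from assms obtain a where
    "\<forall>g. s g = (\<Sum>l\<in>set_mset A. \<Sum>j<count A l. a l j * jordan_seq l j g)"
    unfolding jordan_span_def by blast
  then show ?thesis unfolding jordan_span_def
    by (auto intro!: exI[of _ "\<lambda>l j. c * a l j"] simp: sum_distrib_left mult_ac)
qed

lemma jordan_span_sum:
  assumes "\<And>i. i \<in> I \<Longrightarrow> f i \<in> jordan_span A"
  shows "(\<lambda>g. \<Sum>i\<in>I. f i g) \<in> jordan_span A"
proof (cases "finite I")
  case True
  then show ?thesis using assms
  proof (induction I)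
    case empty
    show ?case by (auto simp: jordan_span_def intro!: exI[of _ "\<lambda>_ _. 0"])
  qed (auto intro!: jordan_span_add)
next
  case False
  then show ?thesis by (auto simp: jordan_span_def intro!: exI[of _ "\<lambda>_ _. 0"])
qed

lemma jordan_seq_in_span:
  assumes "j < count A l"
  shows "jordan_seq l j \<in> jordan_span A"
  unfolding jordan_span_def
proof (intro CollectI exI allI)
  fix g
  have "l \<in># A" using assms by (metis count_inI not_less_zero)
  have "(\<Sum>l'\<in>set_mset A. \<Sum>j'<count A l'. (if l' = l \<and> j' = j then 1 else 0) * jordan_seq l' j' g)
      = (\<Sum>l'\<in>set_mset A. \<Sum>j'<count A l'. if l' = l then if j' = j then jordan_seq l j g else 0 else 0)"
    by (intro sum.cong refl) simp
  also have "\<dots> = (\<Sum>l'\<in>set_mset A. if l' = l then \<Sum>j'<count A l. if j' = j then jordan_seq l j g else 0 else 0)"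
    by (intro sum.cong refl) simp
  also have "\<dots> = jordan_seq l j g"
    using assms \<open>l \<in># A\<close> by (simp add: sum.delta)
  finally show "jordan_seq l j g = (\<Sum>l'\<in>set_mset A. \<Sum>j'<count A l'.
      (if l' = l \<and> j' = j then 1 else 0) * jordan_seq l' j' g)" ..
qed

text \<open>
  The operator \<open>E - l\<close> can be inverted on Jordan sequences if one allows one more sequence with
  eigenvalue \<open>l\<close>. For \<open>m = l\<close> the next sequence of the block is a preimage. For \<open>m \<noteq> l\<close> the operator
  is \<open>m - l\<close> times the identity plus a step down in \<open>j\<close>, so preimages are found by induction on \<open>j\<close>.
\<close>

lemma jordan_seq_preimage:
  fixes A :: "'a::field multiset"
  assumes "j < count A m"
  shows "\<exists>t \<in> jordan_span (add_mset l A). \<forall>g. t (Suc g) - l * t g = jordan_seq m j g"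
proof (cases "m = l")
  case True
  then have "jordan_seq m (Suc j) \<in> jordan_span (add_mset l A)"
    using assms by (intro jordan_seq_in_span) auto
  then show ?thesis
    by (rule bexI[rotated]) (simp add: True jordan_seq_Suc_Suc)
next
  case False
  show ?thesis using assms
  proof (induction j)
    case 0
    have "(\<lambda>g. inverse (m - l) * jordan_seq m 0 g) \<in> jordan_span (add_mset l A)"
      using 0 False by (intro jordan_span_scale jordan_seq_in_span) auto
    then show ?case
      by (rule bexI[rotated]) (use False in \<open>simp add: jordan_seq_Suc_0 divide_simps\<close>,
          simp add: algebra_simps)
  next
    case (Suc j)
    then obtain t where t: "t \<in> jordan_span (add_mset l A)"
      "\<And>g. t (Suc g) - l * t g = jordan_seq m j g" by force
    let ?t = "\<lambda>g. inverse (m - l) * (jordan_seq m (Suc j) g + (- 1) * t g)"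
    have "?t \<in> jordan_span (add_mset l A)"
      using Suc.prems False t(1)
      by (intro jordan_span_scale jordan_span_add jordan_seq_in_span) auto
    moreover have "?t (Suc g) - l * ?t g = jordan_seq m (Suc j) g" for g
    proof -
      have "?t (Suc g) - l * ?t g = inverse (m - l) *
         (m * jordan_seq m (Suc j) g + jordan_seq m j g - (t (Suc g) - l * t g) - l * jordan_seq m (Suc j) g)"
        by (simp add: jordan_seq_Suc_Suc algebra_simps)
      also have "\<dots> = inverse (m - l) * (m - l) * jordan_seq m (Suc j) g"
        by (simp only: t(2)) (simp add: algebra_simps)
      finally show ?thesis using False by simp
    qed
    ultimately show ?case by (intro bexI[of _ ?t] allI)
  qed
qed

text \<open>
  Removing one linear factor \<open>E - l\<close> at a time: the image \<open>t\<close> of \<open>s\<close> under \<open>E - l\<close> is killed by the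
  remaining factors, hence lies in their span. It has a preimage \<open>s'\<close> in the larger span, and \<open>s - s'\<close>
  lies in the kernel of \<open>E - l\<close>, that is, it is a multiple of the powers of \<open>l\<close>.
\<close>

lemma jordan_span_if_killed:
  fixes A :: "'a::field multiset"
  assumes "poly_shift (\<Prod>l\<in>#A. [:- l, 1:]) s = (\<lambda>n. 0)"
  shows "s \<in> jordan_span A"
  using assms
proof (induction A arbitrary: s)
  case empty
  then have "s = (\<lambda>n. 0)" by (simp add: fun_eq_iff poly_shift_def)
  then show ?case by (auto simp: jordan_span_def)
next
  case (add l A)
  define t where "t = poly_shift [:- l, 1:] s"
  have "t \<in> jordan_span A"
    by (rule add.IH) (use add.prems in \<open>simp add: t_def poly_shift_mult[symmetric] mult.commute\<close>)
  then obtain a where a: "\<And>g. t g = (\<Sum>m\<in>set_mset A. \<Sum>j<count A m. a m j * jordan_seq m j g)"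
    unfolding jordan_span_def by blast
  obtain r where r: "\<And>m j. j < count A m \<Longrightarrow> r m j \<in> jordan_span (add_mset l A)"
    "\<And>m j g. j < count A m \<Longrightarrow> r m j (Suc g) - l * r m j g = jordan_seq m j g"
  proof -
    \<comment> \<open>A preimage is chosen for every Jordan sequence at once.\<close>
    define T where "T m j = {t \<in> jordan_span (add_mset l A). \<forall>g. t (Suc g) - l * t g = jordan_seq m j g}" for m j
    have "(SOME t. t \<in> T m j) \<in> T m j" if "j < count A m" for m j
      using jordan_seq_preimage[OF that, of l] unfolding some_in_eq by (auto simp: T_def)
    then have "(SOME t. t \<in> T m j) \<in> jordan_span (add_mset l A)"
      "(SOME t. t \<in> T m j) (Suc g) - l * (SOME t. t \<in> T m j) g = jordan_seq m j g"
      if "j < count A m" for m j g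
      using that unfolding T_def by blast+
    then show ?thesis by (rule that[of "\<lambda>m j. SOME t. t \<in> T m j"])
  qed
  \<comment> \<open>Linearity carries the preimages of the Jordan sequences over to a preimage of \<open>t\<close>.\<close>
  define s' where "s' = (\<lambda>g. \<Sum>m\<in>set_mset A. \<Sum>j<count A m. a m j * r m j g)"
  have s': "s' \<in> jordan_span (add_mset l A)"
    unfolding s'_def
    by (rule jordan_span_sum, rule jordan_span_sum, rule jordan_span_scale, rule r(1)) simp
  have step: "s' (Suc g) - l * s' g = t g" for g
  proof -
    have "s' (Suc g) - l * s' g =
      (\<Sum>m\<in>set_mset A. \<Sum>j<count A m. a m j * (r m j (Suc g) - l * r m j g))"
      unfolding s'_def
      by (simp add: sum_distrib_left sum_subtractf right_diff_distrib mult.left_commute)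
    also have "\<dots> = t g" unfolding a by (intro sum.cong refl) (simp add: r(2))
    finally show ?thesis .
  qed
  have t: "t g = s (Suc g) - l * s g" for g by (simp add: t_def poly_shift_linear_factor)
  have "s g - s' g = (s 0 - s' 0) * jordan_seq l 0 g" for g
  proof (induction g)
    case 0
    show ?case by (simp add: jordan_seq_def)
  next
    case (Suc g)
    have "s (Suc g) - s' (Suc g) = l * (s g - s' g)"
      using step[of g] t[of g] by (simp add: algebra_simps)
    then show ?case using Suc.IH by (simp add: jordan_seq_Suc_0)
  qed
  then have "s = (\<lambda>g. s' g + (s 0 - s' 0) * jordan_seq l 0 g)"
    by (simp add: fun_eq_iff algebra_simps)
  also have "\<dots> \<in> jordan_span (add_mset l A)"
    by (intro jordan_span_add s' jordan_span_scale jordan_seq_in_span) simp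
  finally show ?case .
qed

section \<open>Linear recurrences with constant coefficients\<close>

definition C_recurrent :: "(nat \<Rightarrow> 'a::comm_ring_1) \<Rightarrow> bool" where
  "C_recurrent s \<longleftrightarrow> (\<exists>d c. \<forall>n. s (n + d) = (\<Sum>i<d. c i * s (n + i)))"

text \<open>
  A recurrence of order \<open>0\<close> forces the zero sequence, which also satisfies one of order \<open>1\<close>.
\<close>

lemma C_recurrent_pos_order:
  assumes "C_recurrent s"
  obtains d c where "d \<ge> 1" "\<And>n. s (n + d) = (\<Sum>i<d. c i * s (n + i))"
proof -
  from assms obtain d c where dc: "\<And>n. s (n + d) = (\<Sum>i<d. c i * s (n + i))"
    unfolding C_recurrent_def by blast
  show ?thesis
  proof (cases "d = 0")
    case True
    with dc have "s n = 0" for n by simp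
    then show ?thesis by (intro that[of 1 "\<lambda>_. 0"]) simp_all
  next
    case False
    then show ?thesis using dc by (intro that[of d c]) simp_all
  qed
qed

lemma C_recurrent_if_killed:
  assumes "Polynomial.lead_coeff p = 1" "poly_shift p s = (\<lambda>n. 0)"
  shows "C_recurrent s"
proof -
  have "s (n + Polynomial.degree p) =
      (\<Sum>i<Polynomial.degree p. - Polynomial.coeff p i * s (n + i))" for n
  proof -
    have "s (n + Polynomial.degree p) +
        (\<Sum>i<Polynomial.degree p. Polynomial.coeff p i * s (n + i)) = poly_shift p s n"
      using assms(1) unfolding poly_shift_def lessThan_Suc_atMost[symmetric] by simp
    then show ?thesis using assms(2) by (simp add: sum_negf eq_neg_iff_add_eq_0)
  qed
  then show ?thesis unfolding C_recurrent_def
    by (intro exI[of _ "Polynomial.degree p"] exI[of _ "\<lambda>i. - Polynomial.coeff p i"]) simp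
qed

lemma killed_if_C_recurrent:
  assumes "C_recurrent s"
  shows "\<exists>p. Polynomial.lead_coeff p = 1 \<and> Polynomial.degree p \<ge> 1 \<and> poly_shift p s = (\<lambda>n. 0)"
proof -
  from assms obtain d c where dc: "d \<ge> 1" "\<And>n. s (n + d) = (\<Sum>i<d. c i * s (n + i))"
    by (rule C_recurrent_pos_order) (rule that)
  define p where "p = Polynomial.monom 1 d - (\<Sum>i<d. Polynomial.monom (c i) i)"
  have cf: "Polynomial.coeff p i = (if i = d then 1 else if i < d then - c i else 0)" for i
    by (simp add: p_def coeff_sum)
  have "Polynomial.degree p = d"
    by (rule antisym, rule degree_le) (auto simp: cf intro: le_degree)
  moreover have "poly_shift p s n = 0" for n
    unfolding poly_shift_def \<open>Polynomial.degree p = d\<close> lessThan_Suc_atMost[symmetric]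
    by (simp add: cf dc(2) sum_negf)
  ultimately show ?thesis using dc(1) by (intro exI[of _ p]) (simp add: cf fun_eq_iff)
qed

text \<open>
  A recurrence over the algebraic closure descends to the base field: a linear functional \<open>f\<close>, over
  the base field, from the closure to the base field with \<open>f 1 = 1\<close> maps the coefficients of the
  recurrence to coefficients in the base field, and the leading coefficient stays \<open>1\<close>.
\<close>

lemma C_recurrent_to_ac_iff:
  fixes s :: "nat \<Rightarrow> 'k::field"
  shows "C_recurrent (\<lambda>n. to_ac (s n)) \<longleftrightarrow> C_recurrent s"
proof
  assume "C_recurrent s"
  then obtain d c where "\<And>n. s (n + d) = (\<Sum>i<d. c i * s (n + i))"
    unfolding C_recurrent_def by blast
  then show "C_recurrent (\<lambda>n. to_ac (s n))"
    unfolding C_recurrent_def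
    by (intro exI[of _ d] exI[of _ "\<lambda>i. to_ac (c i)"] allI) (simp_all add: to_ac_sum)
next
  assume "C_recurrent (\<lambda>n. to_ac (s n))"
  then obtain d c where dc: "\<And>n. to_ac (s (n + d)) = (\<Sum>i<d. c i * to_ac (s (n + i)))"
    unfolding C_recurrent_def by blast
  interpret vector_space_pair "\<lambda>(x::'k) y. to_ac x * y" "(*) :: 'k \<Rightarrow> 'k \<Rightarrow> 'k"
    by standard (simp_all add: algebra_simps)
  have "vs1.independent {1}"
    by (simp add: vs1.dependent_single)
  from linear_independent_extend[OF this, of "\<lambda>_. 1"] obtain f where
    
    f: "Vector_Spaces.linear (\<lambda>(x::'k) y. to_ac x * y) ((*) :: 'k \<Rightarrow> 'k \<Rightarrow> 'k) f" "f 1 = 1" by auto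
  interpret f: Vector_Spaces.linear "\<lambda>(x::'k) y. to_ac x * y" "(*) :: 'k \<Rightarrow> 'k \<Rightarrow> 'k" f by (rule f(1))
  have "s (n + d) = (\<Sum>i<d. f (c i) * s (n + i))" for n
  proof -
    have "f (to_ac (s (n + d)) * 1) = s (n + d) * f 1" by (rule f.scale)
    then have "s (n + d) = f (to_ac (s (n + d)))" using f(2) by simp
    also have "\<dots> = (\<Sum>i<d. f (to_ac (s (n + i)) * c i))"
      by (simp add: dc f.sum mult.commute)
    also have "\<dots> = (\<Sum>i<d. s (n + i) * f (c i))"
      by (simp only: f.scale)
    finally show ?thesis by (simp add: mult.commute)
  qed
  then show "C_recurrent s" unfolding C_recurrent_def
    by (intro exI[of _ d] exI[of _ "\<lambda>i. f (c i)"]) simp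
qed

text \<open>
  If \<open>s\<close> is recurrent, its monic polynomial splits into linear factors, and the multiplicities of
  the distinct roots, sorted decreasingly, form the partition. Conversely, the closed form is killed
  by the product of the factors \<open>(E - \<lambda>\<^sub>i) ^ m\<^sub>i\<close>; since it describes \<open>s\<close> only from the largest part
  of the partition on, one more factor \<open>E ^ M\<close> is needed to kill \<open>s\<close> itself.
\<close>

lemma C_recurrent_iff_jordan_sum:
  fixes s :: "nat \<Rightarrow> 'a::alg_closed_field"
  shows "C_recurrent s \<longleftrightarrow>
    (\<exists>(N::nat) ms (lam :: nat \<Rightarrow> 'a) (a :: nat \<Rightarrow> nat \<Rightarrow> 'a).
       N \<ge> 1 \<and> is_partition N ms \<and>
       (\<forall>g \<ge> Max (set ms).
          s g = (\<Sum>i<length ms. \<Sum>j<ms ! i. a i j * of_nat (g choose j) * lam i ^ (g - j))))"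
    (is "_ \<longleftrightarrow> ?closed_form")
proof
  assume "C_recurrent s"
  then obtain p where p: "Polynomial.lead_coeff p = 1" "Polynomial.degree p \<ge> 1" "poly_shift p s = (\<lambda>n. 0)"
    using killed_if_C_recurrent by blast
  have "p \<noteq> 0" using p(1) by auto
  then obtain A where A: "size A = Polynomial.degree p" "p = (\<Prod>x\<in>#A. [:-x, 1:])"
    using alg_closed_imp_factorization[of p] p(1) by auto
  have "s \<in> jordan_span A" using p(3) A(2) by (intro jordan_span_if_killed) simp
  then obtain b where b: "\<And>g. s g = (\<Sum>l\<in>set_mset A. \<Sum>j<count A l. b l j * jordan_seq l j g)"
    unfolding jordan_span_def by blast
  obtain ys where ys: "set ys = set_mset A" "distinct ys"
    using finite_distinct_list[of "set_mset A"] by auto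
  define xs where "xs = rev (sort_key (count A) ys)"
  have xs: "set xs = set_mset A" "distinct xs" by (simp_all add: xs_def ys)
  define ms where "ms = map (count A) xs"
  have "sum_list ms = size A"
    by (simp add: ms_def sum_list_distinct_conv_sum_set xs size_multiset_overloaded_eq)
  moreover have "\<forall>m\<in>set ms. m \<ge> 1"
    by (auto simp: ms_def xs Suc_le_eq)
  moreover have "sorted_wrt (\<ge>) ms"
    unfolding ms_def xs_def by (simp add: rev_map[symmetric] sorted_wrt_rev)
  ultimately have "is_partition (size A) ms" by (simp add: is_partition_def)
  moreover have "s g = (\<Sum>i<length ms. \<Sum>j<ms ! i.
      b (xs ! i) j * of_nat (g choose j) * (xs ! i) ^ (g - j))" for g
  proof -
    have "s g = (\<Sum>i<length xs. \<Sum>j<count A (xs ! i). b (xs ! i) j * jordan_seq (xs ! i) j g)"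
      unfolding b
      by (rule sum.reindex_bij_betw[symmetric], rule bij_betw_nth[OF xs(2) refl xs(1)[symmetric]])
    then show ?thesis by (simp add: ms_def jordan_seq_def mult.assoc)
  qed
  moreover have "size A \<ge> 1" using A(1) p(2) by simp
  ultimately show ?closed_form
    by (intro exI[of _ "size A"] exI[of _ ms] exI[of _ "\<lambda>i. xs ! i"] exI[of _ "\<lambda>i. b (xs ! i)"]
        conjI allI impI)
next
  assume ?closed_form
  then obtain ms and lam :: "nat \<Rightarrow> 'a" and a :: "nat \<Rightarrow> nat \<Rightarrow> 'a" where
    s: "\<And>g. g \<ge> Max (set ms) \<Longrightarrow>
      s g = (\<Sum>i<length ms. \<Sum>j<ms ! i. a i j * of_nat (g choose j) * lam i ^ (g - j))"
    by blast
  \<comment> \<open>The factor \<open>1\<close> makes both sums linear combinations, as \<open>poly_shift_sum\<close> expects them.\<close>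
  define F where "F g = (\<Sum>i<length ms. 1 * (\<Sum>j<ms ! i. a i j * jordan_seq (lam i) j g))" for g
  define P where "P = (\<Prod>i<length ms. [:- lam i, 1:] ^ (ms ! i))"
  let ?M = "Max (set ms)"
  have "poly_shift P (jordan_seq (lam i) j) = (\<lambda>n. 0)" if "i < length ms" "j < ms ! i" for i j
  proof (rule poly_shift_dvd_zero[OF _ poly_shift_jordan_seq])
    have "[:- lam i, 1:] ^ Suc j dvd [:- lam i, 1:] ^ (ms ! i)"
      using that(2) by (intro le_imp_power_dvd) simp
    also have "\<dots> dvd P" unfolding P_def using that(1) by (intro dvd_prodI) auto
    finally show "[:- lam i, 1:] ^ Suc j dvd P" .
  qed
  then have PF: "poly_shift P F n = 0" for n
    unfolding F_def poly_shift_sum by (intro sum.neutral ballI) simp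
  have "poly_shift (Polynomial.monom 1 ?M * P) s n = 0" for n
  proof -
    \<comment> \<open>From the index \<open>?M\<close> on, \<open>s\<close> agrees with the closed form \<open>F\<close>.\<close>
    have "s (n + ?M + i) = F (n + ?M + i)" for i
      unfolding F_def by (subst s) (simp_all add: jordan_seq_def mult.assoc)
    then have "poly_shift P s (n + ?M) = poly_shift P F (n + ?M)"
      unfolding poly_shift_def by (intro sum.cong refl) simp
    then show ?thesis by (simp add: poly_shift_mult poly_shift_monom PF)
  qed
  moreover have "Polynomial.lead_coeff (Polynomial.monom 1 ?M * P) = 1"
    unfolding P_def by (simp add: lead_coeff_mult lead_coeff_prod lead_coeff_power Polynomial.degree_monom_eq)
  ultimately show "C_recurrent s" by (intro C_recurrent_if_killed) auto
qed

section \<open>Colourings as numbers in base \<open>d\<close>\<close>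

text \<open>
  Numbers below \<open>M * N\<close> are used as pairs: remainder and quotient by \<open>M\<close>.
\<close>

lemma sum_mult_index:
  fixes f :: "nat \<Rightarrow> 'a::comm_monoid_add"
  shows "(\<Sum>p<M * N. f p) = (\<Sum>j<N. \<Sum>i<M. f (i + M * j))"
proof (induction N)
  case (Suc N)
  have "(\<Sum>p<M * Suc N. f p) = (\<Sum>p<M * N. f p) + (\<Sum>p=M*N..<M*N+M. f p)"
    by (simp only: lessThan_atLeast0 mult_Suc_right add.commute[of M] sum.atLeastLessThan_concat zero_le le_add1)
  also have "(\<Sum>p=M*N..<M*N+M. f p) = (\<Sum>i<M. f (i + M * N))"
    using sum.shift_bounds_nat_ivl[of f 0 "M * N" M] by (simp add: lessThan_atLeast0 add.commute)
  finally show ?case by (simp add: Suc.IH)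
qed simp

text \<open>
  A colouring of circles \<open>0, \<dots>, n - 1\<close> by \<open>d\<close> colours is encoded as a number below \<open>d ^ n\<close>; circle
  \<open>i\<close> has as colour the \<open>i\<close>-th digit in base \<open>d\<close>. Juxtaposition of colourings is then strictly
  associative.
\<close>

definition digit :: "nat \<Rightarrow> nat \<Rightarrow> nat \<Rightarrow> nat" where
  "digit d p i = p div d ^ i mod d"

lemma digit_less: "d > 0 \<Longrightarrow> digit d p i < d"
  by (simp add: digit_def)

lemma digit_div: "digit d (p div d ^ n) i = digit d p (n + i)"
  by (simp add: digit_def div_mult2_eq power_add)

lemma digit_mod:
  assumes "i < n"
  shows "digit d (p mod d ^ n) i = digit d p i"
proof -
  from assms have "d ^ n = d ^ i * (d * d ^ (n - Suc i))"
    by (metis Suc_leI add_diff_inverse_nat le_imp_less_Suc not_less power_Suc power_add mult.assoc add_Suc_right add_Suc)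
  then show ?thesis
    unfolding digit_def
    by (cases "d = 0") (auto simp: mod_mult2_eq zero_power)
qed

lemma digits_eq_iff:
  assumes "d > 0"
  shows "(\<forall>i<n. digit d p i = digit d q i) \<longleftrightarrow> p mod d ^ n = q mod d ^ n"
proof (induction n)
  case (Suc n)
  have split: "r mod d ^ Suc n = d ^ n * digit d r n + r mod d ^ n" for r
    unfolding digit_def power_Suc2 by (rule mod_mult2_eq)
  have "d ^ n * digit d p n + p mod d ^ n = d ^ n * digit d q n + q mod d ^ n \<longleftrightarrow>
      digit d p n = digit d q n \<and> p mod d ^ n = q mod d ^ n" (is "?l \<longleftrightarrow> ?r")
  proof
    assume ?l
    then have "(d ^ n * digit d p n + p mod d ^ n) div d ^ n = (d ^ n * digit d q n + q mod d ^ n) div d ^ n"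
      "(d ^ n * digit d p n + p mod d ^ n) mod d ^ n = (d ^ n * digit d q n + q mod d ^ n) mod d ^ n"
      by simp_all
    then show ?r using assms by simp
  qed simp
  then show ?case using Suc.IH unfolding split less_Suc_eq by auto
qed simp

text \<open>
  Distributivity: summing a product over all colourings is summing in each factor over its colour.
\<close>

lemma sum_prod_digits:
  fixes f :: "nat \<Rightarrow> nat \<Rightarrow> 'a::comm_semiring_1"
  assumes "d > 0"
  shows "(\<Sum>p<d ^ m. \<Prod>j<m. f j (digit d p j)) = (\<Prod>j<m. \<Sum>b<d. f j b)"
proof (induction m)
  case (Suc m)
  have "digit d (i + d ^ m * b) j = digit d i j" if "i < d ^ m" "j < m" for i b j
    using digit_mod[OF that(2), of d "i + d ^ m * b"] digit_mod[OF that(2), of d i] that(1) by simp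
  moreover have "digit d (i + d ^ m * b) m = b" if "i < d ^ m" "b < d" for i b
    using that by (simp add: digit_def)
  ultimately have "(\<Sum>p<d ^ m * d. \<Prod>j<Suc m. f j (digit d p j)) =
      (\<Sum>b<d. \<Sum>i<d ^ m. (\<Prod>j<m. f j (digit d i j)) * f m b)"
    unfolding sum_mult_index by (intro sum.cong refl) simp
  also have "\<dots> = (\<Sum>p<d ^ m. \<Prod>j<m. f j (digit d p j)) * (\<Sum>b<d. f m b)"
    by (simp add: sum_distrib_left sum_distrib_right)
  finally show ?case using Suc.IH by (simp add: mult.commute)
qed simp

section \<open>Gluing circle by circle\<close>

text \<open>
  A multiset on which \<open>f\<close> hits every number below \<open>m\<close> exactly once can be indexed by these numbers.
\<close>

lemma image_mset_eq_mset_setD: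
  assumes "image_mset f A = mset_set {..<m::nat}"
  shows "\<exists>c. A = image_mset c (mset_set {..<m}) \<and> (\<forall>j<m. f (c j) = j)"
  using assms
proof (induction m arbitrary: A)
  case (Suc m)
  have "image_mset f A = add_mset m (mset_set {..<m})"
    using Suc.prems by (simp add: lessThan_Suc)
  then obtain A' x where A: "A = add_mset x A'" "f x = m" "image_mset f A' = mset_set {..<m}"
    using msed_map_invR by metis
  from Suc.IH[OF A(3)] obtain c where c: "A' = image_mset c (mset_set {..<m})" "\<forall>j<m. f (c j) = j"
    by blast
  have "image_mset (c(m := x)) (mset_set {..<m}) = A'"
    unfolding c(1) by (intro image_mset_cong) auto
  then have "A = image_mset (c(m := x)) (mset_set {..<Suc m})"
    unfolding A(1) lessThan_Suc by simp
  moreover have "\<forall>j<Suc m. f ((c(m := x)) j) = j"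
    using A(2) c(2) by (simp add: less_Suc_eq)
  ultimately show ?case by blast
qed simp

text \<open>
  Since every circle bounds exactly one component, the components with an out-boundary can be
  indexed by their out-circle. This turns multisets of components into families, over which the
  sums and products below are ordinary indexed ones.
\<close>

lemma out_components:
  assumes "out_circles W = mset_set {..<m}"
  obtains c where
    "W = filter_mset (\<lambda>x. out_circle x = None) W + image_mset c (mset_set {..<m})"
    "\<And>j. j < m \<Longrightarrow> out_circle (c j) = Some j"
proof -
  obtain c where c: "filter_mset (\<lambda>x. out_circle x \<noteq> None) W = image_mset c (mset_set {..<m})"
    "\<forall>j<m. the (out_circle (c j)) = j"
    using image_mset_eq_mset_setD[OF assms[unfolded out_circles_def]] by blast
  have "out_circle (c j) \<noteq> None" if "j < m" for j
  proof -
    have "c j \<in># filter_mset (\<lambda>x. out_circle x \<noteq> None) W" unfolding c(1) using that by simp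
    then show ?thesis by simp
  qed
  with c(2) have "out_circle (c j) = Some j" if "j < m" for j using that by force
  moreover have "W = filter_mset (\<lambda>x. out_circle x = None) W + image_mset c (mset_set {..<m})"
    unfolding c(1)[symmetric] by (rule multiset_partition)
  ultimately show ?thesis using that by blast
qed

lemma in_components:
  assumes "in_circles W = mset_set {..<m}"
  obtains c where
    "W = filter_mset (\<lambda>x. in_circle x = None) W + image_mset c (mset_set {..<m})"
    "\<And>j. j < m \<Longrightarrow> in_circle (c j) = Some j"
proof -
  obtain c where c: "filter_mset (\<lambda>x. in_circle x \<noteq> None) W = image_mset c (mset_set {..<m})"
    "\<forall>j<m. the (in_circle (c j)) = j"
    using image_mset_eq_mset_setD[OF assms[unfolded in_circles_def]] by blast
  have "in_circle (c j) \<noteq> None" if "j < m" for j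
  proof -
    have "c j \<in># filter_mset (\<lambda>x. in_circle x \<noteq> None) W" unfolding c(1) using that by simp
    then show ?thesis by simp
  qed
  with c(2) have "in_circle (c j) = Some j" if "j < m" for j using that by force
  moreover have "W = filter_mset (\<lambda>x. in_circle x = None) W + image_mset c (mset_set {..<m})"
    unfolding c(1)[symmetric] by (rule multiset_partition)
  ultimately show ?thesis using that by blast
qed

lemma sum_mset_indexed:
  assumes "W = F + image_mset c (mset_set {..<m::nat})" "\<And>x. x \<in># F \<Longrightarrow> f x = 0"
  shows "(\<Sum>x\<in>#W. f x) = (\<Sum>j<m. f (c j))"
proof -
  have "(\<Sum>x\<in>#F. f x) = 0" using assms(2) by (intro sum_mset.neutral) auto
  moreover have "(\<Sum>x\<in>#image_mset c (mset_set {..<m}). f x) = (\<Sum>j<m. f (c j))"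
    by (simp only: multiset.map_comp sum_unfold_sum_mset o_def)
  ultimately show ?thesis by (simp add: assms(1))
qed

definition glue :: "component \<Rightarrow> component \<Rightarrow> component" where
  "glue c c' = Component (in_circle c) (out_circle c') (genus c + genus c')"

text \<open>
  Gluing is circle by circle: the double sum over all pairs of components collapses to the pairs that
  meet in a common circle.
\<close>

lemma tb_comp_eq:
  assumes W: "W = filter_mset (\<lambda>x. out_circle x = None) W + image_mset c (mset_set {..<m})"
    "\<And>j. j < m \<Longrightarrow> out_circle (c j) = Some j"
    and W': "W' = filter_mset (\<lambda>x. in_circle x = None) W' + image_mset c' (mset_set {..<m})"
    "\<And>j. j < m \<Longrightarrow> in_circle (c' j) = Some j"
  shows "tb_comp W W' = filter_mset (\<lambda>x. out_circle x = None) W + filter_mset (\<lambda>x. in_circle x = None) W' +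
    image_mset (\<lambda>j. glue (c j) (c' j)) (mset_set {..<m})"
proof -
  let ?g = "\<lambda>x x'. if out_circle x \<noteq> None \<and> out_circle x = in_circle x' then {#glue x x'#} else {#}"
  have "(\<Sum>x'\<in>#W'. ?g x x') = (\<Sum>j<m. ?g x (c' j))" for x
    by (rule sum_mset_indexed[OF W'(1)]) auto
  then have "(\<Sum>x\<in>#W. \<Sum>x'\<in>#W'. ?g x x') = (\<Sum>x\<in>#W. \<Sum>j<m. ?g x (c' j))"
    by (simp only:)
  also have "\<dots> = (\<Sum>i<m. \<Sum>j<m. ?g (c i) (c' j))"
    by (rule sum_mset_indexed[OF W(1)]) auto
  also have "\<dots> = (\<Sum>i<m. \<Sum>j<m. if j = i then {#glue (c i) (c' i)#} else {#})"
    by (intro sum.cong refl) (auto simp: W(2) W'(2))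
  also have "\<dots> = image_mset (\<lambda>j. glue (c j) (c' j)) (mset_set {..<m})"
  proof -
    have "(\<Sum>i<k. {#h i#}) = image_mset h (mset_set {..<k})" for h :: "nat \<Rightarrow> component" and k
      by (induction k) (simp_all add: lessThan_Suc)
    then show ?thesis by simp
  qed
  finally show ?thesis unfolding tb_comp_def glue_def by simp
qed

lemma size_circles:
  assumes "W \<in> Tb n m"
  shows "size (in_circles W) = n" "size (out_circles W) = m"
  using assms by (simp_all add: Tb_def)

lemma circles_add [simp]:
  "in_circles (W + W') = in_circles W + in_circles W'"
  "out_circles (W + W') = out_circles W + out_circles W'"
  by (simp_all add: in_circles_def out_circles_def)

lemma tb_id_in_Tb: "tb_id n \<in> Tb n n"
  by (simp add: Tb_def tb_id_def in_circles_def out_circles_def filter_mset_image_mset multiset.map_comp o_def)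

lemma mset_set_lessThan_add:
  "mset_set {..<n + m :: nat} = mset_set {..<n} + image_mset (\<lambda>i. n + i) (mset_set {..<m})"
  by (induction m) (simp_all add: lessThan_Suc)

lemma tb_swap_in_Tb: "tb_swap m n \<in> Tb (m + n) (n + m)"
  unfolding Tb_def tb_swap_def
  by (simp add: in_circles_def out_circles_def filter_mset_image_mset multiset.map_comp o_def
      mset_set_lessThan_add add.commute[of "image_mset (\<lambda>x. x + n) _"]
      add.commute[of "image_mset (\<lambda>x. n + x) _"])

lemma tb_disj_in_Tb:
  assumes "W \<in> Tb n m" "W' \<in> Tb n' m'"
  shows "tb_disj n m W W' \<in> Tb (n + n') (m + m')"
proof -
  let ?W = "{# Component (map_option (\<lambda>i. n + i) (in_circle c))
              (map_option (\<lambda>j. m + j) (out_circle c)) (genus c). c \<in># W' #}"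
  have "in_circles ?W = image_mset (\<lambda>i. n + i) (in_circles W')"
    unfolding in_circles_def filter_mset_image_mset multiset.map_comp
    by (auto intro!: image_mset_cong simp: o_def)
  moreover have "out_circles ?W = image_mset (\<lambda>i. m + i) (out_circles W')"
    unfolding out_circles_def filter_mset_image_mset multiset.map_comp
    by (auto intro!: image_mset_cong simp: o_def)
  ultimately show ?thesis using assms
    by (simp add: tb_disj_def Tb_def mset_set_lessThan_add)
qed

lemma tb_comp_in_Tb:
  assumes "W \<in> Tb n m" "W' \<in> Tb m l"
  shows "tb_comp W W' \<in> Tb n l"
proof -
  obtain c where c: "W = filter_mset (\<lambda>x. out_circle x = None) W + image_mset c (mset_set {..<m})"
    "\<And>j. j < m \<Longrightarrow> out_circle (c j) = Some j"
    using out_components assms(1) unfolding Tb_def by blast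
  obtain c' where c': "W' = filter_mset (\<lambda>x. in_circle x = None) W' + image_mset c' (mset_set {..<m})"
    "\<And>j. j < m \<Longrightarrow> in_circle (c' j) = Some j"
    using in_components assms(2) unfolding Tb_def by blast
  let ?G = "image_mset (\<lambda>j. glue (c j) (c' j)) (mset_set {..<m})"
  have "in_circles ?G = in_circles (image_mset c (mset_set {..<m}))"
    by (simp add: in_circles_def filter_mset_image_mset multiset.map_comp o_def glue_def)
  moreover have "out_circles ?G = out_circles (image_mset c' (mset_set {..<m}))"
    by (simp add: out_circles_def filter_mset_image_mset multiset.map_comp o_def glue_def)
  moreover have "in_circles (filter_mset (\<lambda>x. in_circle x = None) W') = {#}"
    "out_circles (filter_mset (\<lambda>x. out_circle x = None) W) = {#}"
    by (auto simp: in_circles_def out_circles_def filter_mset_eq_conv)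
  moreover have "in_circles W = in_circles (filter_mset (\<lambda>x. out_circle x = None) W) + in_circles (image_mset c (mset_set {..<m}))"
    by (subst c(1)) (rule circles_add)
  moreover have "out_circles W' = out_circles (filter_mset (\<lambda>x. in_circle x = None) W') + out_circles (image_mset c' (mset_set {..<m}))"
    by (subst c'(1)) (rule circles_add)
  moreover have "tb_comp W W' = filter_mset (\<lambda>x. out_circle x = None) W +
      filter_mset (\<lambda>x. in_circle x = None) W' + ?G"
    by (rule tb_comp_eq[OF c c'])
  ultimately show ?thesis using assms by (simp add: Tb_def)
qed

section \<open>Tensor products of coordinate spaces\<close>

definition coord_space :: "nat \<Rightarrow> (nat \<Rightarrow> 'k::field) set" where
  "coord_space N = {x. \<forall>i\<ge>N. x i = 0}"

definition std_vec :: "nat \<Rightarrow> nat \<Rightarrow> 'k::field" where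
  "std_vec k = (\<lambda>i. if i = k then 1 else 0)"

text \<open>
  The Kronecker product of coordinate vectors, with the first factor in the low digits.
\<close>

definition kron :: "nat \<Rightarrow> (nat \<Rightarrow> 'k::field) \<Rightarrow> (nat \<Rightarrow> 'k) \<Rightarrow> nat \<Rightarrow> 'k" where
  "kron M x y = (\<lambda>i. x (i mod M) * y (i div M))"

lemma sum_fun_apply: "(\<Sum>k\<in>A. f k) i = (\<Sum>k\<in>A. f k i)"
  by (induction A rule: infinite_finite_induct) simp_all

lemma coord_space_expand:
  assumes "x \<in> coord_space N"
  shows "x = (\<Sum>k<N. seq_scale (x k) (std_vec k))"
proof
  fix i
  have "(\<Sum>k<N. seq_scale (x k) (std_vec k)) i = (\<Sum>k<N. if k = i then x i else 0)"
    unfolding sum_fun_apply by (intro sum.cong refl) (simp add: seq_scale_def std_vec_def)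
  also have "\<dots> = x i" using assms by (simp add: coord_space_def)
  finally show "x i = (\<Sum>k<N. seq_scale (x k) (std_vec k)) i" ..
qed

lemma std_vec_in_coord_space: "k < N \<Longrightarrow> std_vec k \<in> coord_space N"
  by (simp add: std_vec_def coord_space_def)

lemma subspace_coord_space: "seq.subspace (coord_space N :: (nat \<Rightarrow> 'k::field) set)"
  by (simp add: seq.subspace_def coord_space_def seq_scale_def)

lemma coord_space_eq_span:
  "coord_space N = (seq.span (std_vec ` {..<N}) :: (nat \<Rightarrow> 'k::field) set)"
proof
  show "coord_space N \<subseteq> (seq.span (std_vec ` {..<N}) :: (nat \<Rightarrow> 'k::field) set)"
  proof
    fix x :: "nat \<Rightarrow> 'k"
    assume "x \<in> coord_space N"
    then have "x = (\<Sum>k<N. seq_scale (x k) (std_vec k))" by (rule coord_space_expand)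
    also have "\<dots> \<in> seq.span (std_vec ` {..<N})"
      by (intro seq.span_sum seq.span_scale seq.span_base) auto
    finally show "x \<in> seq.span (std_vec ` {..<N})" .
  qed
  show "seq.span (std_vec ` {..<N}) \<subseteq> (coord_space N :: (nat \<Rightarrow> 'k) set)"
    by (rule seq.span_minimal[OF _ subspace_coord_space]) (auto intro: std_vec_in_coord_space)
qed

lemma fd_space_coord_space: "fd_space (coord_space N)"
  unfolding fd_space_def coord_space_eq_span by blast

lemma fd_space_subspace: "fd_space V \<Longrightarrow> seq.subspace V"
  unfolding fd_space_def by (auto simp: seq.subspace_span)

lemma linear_map_zero:
  assumes "linear_map V W f" "seq.subspace V"
  shows "f 0 = 0"
proof -
  have "f (seq_scale 0 0) = seq_scale 0 (f 0)"
    using assms seq.subspace_0 unfolding linear_map_def by blast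
  then show ?thesis by (simp add: seq_scale_def fun_eq_iff zero_fun_def)
qed

text \<open>
  A map that is linear on a subspace respects linear combinations only of vectors of the subspace,
  so the lemmas on globally linear maps do not apply.
\<close>

lemma linear_map_lincomb:
  assumes f: "linear_map V W f" and V: "seq.subspace V" and v: "\<And>k. k \<in> I \<Longrightarrow> v k \<in> V"
  shows "f (\<Sum>k\<in>I. seq_scale (c k) (v k)) = (\<Sum>k\<in>I. seq_scale (c k) (f (v k)))"
  using v
proof (induction I rule: infinite_finite_induct)
  case (insert k I)
  have "(\<Sum>k\<in>I. seq_scale (c k) (v k)) \<in> V" "seq_scale (c k) (v k) \<in> V" "v k \<in> V"
    using insert.prems V by (auto intro!: seq.subspace_sum seq.subspace_scale)
  then have "f (seq_scale (c k) (v k) + (\<Sum>k\<in>I. seq_scale (c k) (v k))) =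
      seq_scale (c k) (f (v k)) + f (\<Sum>k\<in>I. seq_scale (c k) (v k))"
    using f unfolding linear_map_def by metis
  also have "f (\<Sum>k\<in>I. seq_scale (c k) (v k)) = (\<Sum>k\<in>I. seq_scale (c k) (f (v k)))"
    using insert by simp
  finally show ?case
    by (simp only: sum.insert[OF insert.hyps])
qed (simp_all add: linear_map_zero[OF f V])

lemma linear_map_coord_expand:
  assumes "linear_map (coord_space N) W f" "x \<in> coord_space N"
  shows "f x = (\<Sum>k<N. seq_scale (x k) (f (std_vec k)))"
proof -
  have "f (\<Sum>k<N. seq_scale (x k) (std_vec k)) = (\<Sum>k<N. seq_scale (x k) (f (std_vec k)))"
    by (rule linear_map_lincomb[OF assms(1) subspace_coord_space]) (simp add: std_vec_in_coord_space)
  then show ?thesis by (simp only: coord_space_expand[OF assms(2), symmetric])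
qed

lemma kron_in_coord_space:
  assumes "M > 0" "y \<in> coord_space N"
  shows "kron M x y \<in> coord_space (M * N)"
proof -
  have "i div M \<ge> N" if "i \<ge> M * N" for i
    using that assms(1) by (simp add: less_eq_div_iff_mult_less_eq mult.commute)
  then show ?thesis using assms(2) by (simp add: coord_space_def kron_def)
qed

lemma kron_bilinear:
  assumes "M > 0"
  shows "bilinear_map (coord_space M) (coord_space N) (coord_space (M * N)) (kron M)"
  unfolding bilinear_map_def linear_map_def
proof (intro conjI ballI allI)
  show "kron M x y \<in> coord_space (M * N)" if "y \<in> coord_space N" for x y
    using assms that by (rule kron_in_coord_space)
  then show "kron M x y \<in> coord_space (M * N)" if "y \<in> coord_space N" for x y
    using that .
qed (simp_all add: kron_def seq_scale_def fun_eq_iff algebra_simps)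

lemma kron_std_vec:
  assumes "i < M"
  shows "kron M (std_vec i) (std_vec j) = (std_vec (i + M * j) :: nat \<Rightarrow> 'a::field)"
proof -
  have "(k mod M = i \<and> k div M = j) = (k = i + M * j)" for k
    using assms by auto
  moreover have "kron M (std_vec i) (std_vec j) k = (if k mod M = i \<and> k div M = j then 1 else (0::'a))" for k
    by (simp add: kron_def std_vec_def)
  ultimately show ?thesis by (simp add: fun_eq_iff std_vec_def)
qed

text \<open>
  The products of standard basis vectors are again the standard basis vectors, so a bilinear map
  factors through the product by prescribing it on the basis.
\<close>

lemma kron_is_tensor_product:
  assumes M: "M > 0"
  shows "is_tensor_product (coord_space M) (coord_space N) (coord_space (M * N))
    (kron M :: (nat \<Rightarrow> 'k::field) \<Rightarrow> _)"
  unfolding is_tensor_product_def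
proof (intro conjI allI impI)
  show "bilinear_map (coord_space M) (coord_space N) (coord_space (M * N)) (kron M :: (nat \<Rightarrow> 'k::field) \<Rightarrow> _)"
    by (rule kron_bilinear[OF M])
next
  fix U :: "(nat \<Rightarrow> 'k) set" and \<gamma>
  assume "fd_space U \<and> bilinear_map (coord_space M) (coord_space N) U \<gamma>"
  then have U: "seq.subspace U" and \<gamma>: "bilinear_map (coord_space M) (coord_space N) U \<gamma>"
    by (simp_all add: fd_space_subspace)
  have \<gamma>1: "linear_map (coord_space N) U (\<gamma> x)" if "x \<in> coord_space M" for x
    using \<gamma> that by (simp add: bilinear_map_def)
  have \<gamma>2: "linear_map (coord_space M) U (\<lambda>x. \<gamma> x y)" if "y \<in> coord_space N" for y
    using \<gamma> that by (simp add: bilinear_map_def)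
  define f where "f p = (\<Sum>j<N. \<Sum>i<M. seq_scale (p (i + M * j)) (\<gamma> (std_vec i) (std_vec j)))" for p
  have "\<gamma> (std_vec i) (std_vec j) \<in> U" if "i < M" "j < N" for i j
    using \<gamma>1[of "std_vec i"] that std_vec_in_coord_space unfolding linear_map_def by blast
  then have "f p \<in> U" for p
    unfolding f_def by (intro seq.subspace_sum[OF U] seq.subspace_scale[OF U]) simp
  moreover have "f (p + q) = f p + f q" for p q
    unfolding f_def by (simp only: plus_fun_apply seq.scale_left_distrib sum.distrib)
  moreover have "f (seq_scale c p) = seq_scale c (f p)" for c p
    unfolding f_def by (simp only: seq.scale_sum_right seq.scale_scale) (simp only: seq_scale_def)
  ultimately have "linear_map (coord_space (M * N)) U f"
    unfolding linear_map_def by blast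
  moreover have "f (kron M x y) = \<gamma> x y" if x: "x \<in> coord_space M" and y: "y \<in> coord_space N" for x y
  proof -
    have "f (kron M x y) = (\<Sum>j<N. \<Sum>i<M. seq_scale (x i * y j) (\<gamma> (std_vec i) (std_vec j)))"
      unfolding f_def by (intro sum.cong refl) (simp add: kron_def)
    also have "\<dots> = (\<Sum>j<N. seq_scale (y j) (\<Sum>i<M. seq_scale (x i) (\<gamma> (std_vec i) (std_vec j))))"
      by (simp add: seq.scale_sum_right mult.commute)
    also have "\<dots> = (\<Sum>j<N. seq_scale (y j) (\<gamma> x (std_vec j)))"
      by (intro sum.cong refl) (simp add: linear_map_coord_expand[OF \<gamma>2 x] std_vec_in_coord_space)
    also have "\<dots> = \<gamma> x y"
      by (rule linear_map_coord_expand[OF \<gamma>1[OF x] y, symmetric])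
    finally show ?thesis .
  qed
  ultimately show "\<exists>f. linear_map (coord_space (M * N)) U f \<and>
      (\<forall>x\<in>coord_space M. \<forall>y\<in>coord_space N. f (kron M x y) = \<gamma> x y)" by blast
next
  fix U :: "(nat \<Rightarrow> 'k) set" and \<gamma> f f'
  assume "fd_space U \<and> bilinear_map (coord_space M) (coord_space N) U \<gamma>"
  assume ff': "linear_map (coord_space (M * N)) U f \<and>
      (\<forall>x\<in>coord_space M. \<forall>y\<in>coord_space N. f (kron M x y) = \<gamma> x y) \<and>
      linear_map (coord_space (M * N)) U f' \<and>
      (\<forall>x\<in>coord_space M. \<forall>y\<in>coord_space N. f' (kron M x y) = \<gamma> x y)"
  have "f (std_vec k) = f' (std_vec k)" if "k < M * N" for k
  proof -
    have k: "k mod M < M" "k div M < N" using that M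
      by (simp_all add: less_mult_imp_div_less mult.commute)
    have "std_vec k = kron M (std_vec (k mod M)) (std_vec (k div M) :: nat \<Rightarrow> 'k)"
      by (simp add: kron_std_vec[OF k(1)])
    then show ?thesis using ff' k std_vec_in_coord_space by metis
  qed
  moreover have "linear_map (coord_space (M * N)) U f" "linear_map (coord_space (M * N)) U f'"
    using ff' by blast+
  ultimately show "\<forall>p\<in>coord_space (M * N). f p = f' p"
    using linear_map_coord_expand[of "M * N" U f] linear_map_coord_expand[of "M * N" U f']
    by (metis (no_types, lifting) lessThan_iff sum.cong)
qed

section \<open>Almost-TQFTs from matrix entries\<close>

text \<open>
  The data of an almost-TQFT in coordinates. \<open>K g x y\<close> is the matrix entry of the connected bordism of
  genus \<open>g\<close> whose in-boundary has colour \<open>x\<close> and whose out-boundary has colour \<open>y\<close>, with \<open>None\<close> for an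
  empty boundary. \<open>K_add\<close> says that gluing along a circle is matrix multiplication, and \<open>K_zero\<close> that
  the cylinder is the identity. A disjoint union gets the product of the entries of its components.
\<close>

locale tube_weights =
  fixes d :: nat and K :: "nat \<Rightarrow> nat option \<Rightarrow> nat option \<Rightarrow> 'k::field"
  assumes d_pos: "d > 0"
    and K_zero: "\<lbrakk>a < d; b < d\<rbrakk> \<Longrightarrow> K 0 (Some a) (Some b) = (if a = b then 1 else 0)"
    and K_add: "K (g + h) x y = (\<Sum>b<d. K g x (Some b) * K h (Some b) y)"
begin

definition weight :: "component \<Rightarrow> nat \<Rightarrow> nat \<Rightarrow> 'k" where
  "weight c p q = K (genus c) (map_option (digit d p) (in_circle c)) (map_option (digit d q) (out_circle c))"

definition entry :: "bordism \<Rightarrow> nat \<Rightarrow> nat \<Rightarrow> 'k" where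
  "entry W p q = (\<Prod>c\<in>#W. weight c p q)"

definition space :: "nat \<Rightarrow> (nat \<Rightarrow> 'k) set" where
  "space n = coord_space (d ^ n)"

definition mor :: "bordism \<Rightarrow> (nat \<Rightarrow> 'k) \<Rightarrow> nat \<Rightarrow> 'k" where
  "mor W x = (\<lambda>q. if q < d ^ size (out_circles W)
     then \<Sum>p<d ^ size (in_circles W). x p * entry W p q else 0)"

lemma mor_apply:
  assumes "W \<in> Tb n m"
  shows "mor W x q = (if q < d ^ m then \<Sum>p<d ^ n. x p * entry W p q else 0)"
  by (simp add: mor_def size_circles[OF assms])

lemma mor_linear:
  assumes "W \<in> Tb n m"
  shows "linear_map (space n) (space m) (mor W)"
  unfolding linear_map_def
proof (intro conjI ballI allI)
  show "mor W x \<in> space m" for x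
    by (simp add: space_def coord_space_def mor_apply[OF assms])
  show "mor W (x + y) = mor W x + mor W y" for x y
    by (rule ext) (simp add: mor_def distrib_right sum.distrib)
  show "mor W (seq_scale c x) = seq_scale c (mor W x)" for c x
    by (rule ext) (simp add: mor_def seq_scale_def sum_distrib_left mult.assoc)
qed

lemma entry_add: "entry (W + W') p q = entry W p q * entry W' p q"
  by (simp add: entry_def)

lemma entry_indexed: "entry (image_mset c (mset_set {..<m})) p q = (\<Prod>j<m. weight (c j) p q)"
  by (simp only: entry_def multiset.map_comp prod_unfold_prod_mset o_def)

lemma entry_cong:
  assumes "\<And>c. c \<in># W \<Longrightarrow> weight c p q = weight c p' q'"
  shows "entry W p q = entry W p' q'"
  unfolding entry_def by (rule arg_cong[of _ _ prod_mset]) (auto intro!: image_mset_cong assms)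

text \<open>
  Functoriality. The components without a glued circle do not depend on the intermediate colouring
  \<open>q\<close>, and each glued pair depends on one digit of \<open>q\<close> only. Hence the sum over \<open>q\<close> factors into one
  sum per circle, which \<open>K_add\<close> evaluates to the entry of the glued component.
\<close>

lemma entry_comp:
  assumes "W \<in> Tb n m" "W' \<in> Tb m l"
  shows "entry (tb_comp W W') p r = (\<Sum>q<d ^ m. entry W p q * entry W' q r)"
proof -
  obtain c where c: "W = filter_mset (\<lambda>x. out_circle x = None) W + image_mset c (mset_set {..<m})"
    "\<And>j. j < m \<Longrightarrow> out_circle (c j) = Some j"
    using out_components assms(1) unfolding Tb_def by blast
  obtain c' where c': "W' = filter_mset (\<lambda>x. in_circle x = None) W' + image_mset c' (mset_set {..<m})"
    "\<And>j. j < m \<Longrightarrow> in_circle (c' j) = Some j"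
    using in_components assms(2) unfolding Tb_def by blast
  let ?E = "entry (filter_mset (\<lambda>x. out_circle x = None) W) p r"
  let ?E' = "entry (filter_mset (\<lambda>x. in_circle x = None) W') p r"
  let ?F = "\<lambda>j b. K (genus (c j)) (map_option (digit d p) (in_circle (c j))) (Some b) *
      K (genus (c' j)) (Some b) (map_option (digit d r) (out_circle (c' j)))"
  have "entry W p q * entry W' q r = ?E * ?E' * (\<Prod>j<m. ?F j (digit d q j))" for q
  proof -
    have "entry (filter_mset (\<lambda>x. out_circle x = None) W) p q = ?E"
      "entry (filter_mset (\<lambda>x. in_circle x = None) W') q r = ?E'"
      by (intro entry_cong; auto simp: weight_def)+
    moreover have "entry W p q = entry (filter_mset (\<lambda>x. out_circle x = None) W) p q * (\<Prod>j<m. weight (c j) p q)"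
      by (subst c(1)) (simp only: entry_add entry_indexed)
    moreover have "entry W' q r = entry (filter_mset (\<lambda>x. in_circle x = None) W') q r * (\<Prod>j<m. weight (c' j) q r)"
      by (subst c'(1)) (simp only: entry_add entry_indexed)
    moreover have "(\<Prod>j<m. weight (c j) p q) * (\<Prod>j<m. weight (c' j) q r) = (\<Prod>j<m. ?F j (digit d q j))"
      unfolding prod.distrib[symmetric]
      by (intro prod.cong refl) (simp add: weight_def c(2) c'(2))
    ultimately show ?thesis by (simp add: mult_ac)
  qed
  then have "(\<Sum>q<d ^ m. entry W p q * entry W' q r) = ?E * ?E' * (\<Sum>q<d ^ m. \<Prod>j<m. ?F j (digit d q j))"
    by (simp only: sum_distrib_left)
  also have "\<dots> = ?E * ?E' * (\<Prod>j<m. \<Sum>b<d. ?F j b)"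
    unfolding sum_prod_digits[OF d_pos, of ?F m] ..
  also have "\<dots> = ?E * ?E' * (\<Prod>j<m. weight (glue (c j) (c' j)) p r)"
    by (simp only: K_add[symmetric] weight_def glue_def component.sel)
  also have "\<dots> = entry (tb_comp W W') p r"
    by (simp only: tb_comp_eq[OF c c'] entry_add entry_indexed)
  finally show ?thesis ..
qed

lemma mor_comp:
  assumes W: "W \<in> Tb n m" and W': "W' \<in> Tb m l"
  shows "mor (tb_comp W W') x = mor W' (mor W x)"
proof
  fix r
  have "(\<Sum>p<d ^ n. x p * (\<Sum>q<d ^ m. entry W p q * entry W' q r)) =
      (\<Sum>q<d ^ m. (\<Sum>p<d ^ n. x p * entry W p q) * entry W' q r)"
    by (simp add: sum_distrib_left sum_distrib_right mult.assoc) (rule sum.swap)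
  then show "mor (tb_comp W W') x r = mor W' (mor W x) r"
    by (simp add: mor_apply[OF tb_comp_in_Tb[OF W W']] mor_apply[OF W'] mor_apply[OF W]
        entry_comp[OF W W'])
qed

lemma prod_indicator:
  "(\<Prod>i<n::nat. if P i then 1 else 0 :: 'k) = (if \<forall>i<n. P i then 1 else 0)"
  by (induction n) (auto simp: less_Suc_eq)

lemma entry_cylinders:
  "entry (image_mset (\<lambda>i. Component (Some (a i)) (Some (b i)) 0) (mset_set {..<n::nat})) p q =
    (if \<forall>i<n. digit d p (a i) = digit d q (b i) then 1 else 0)"
proof -
  have "weight (Component (Some (a i)) (Some (b i)) 0) p q =
      (if digit d p (a i) = digit d q (b i) then 1 else 0)" for i
    by (simp add: weight_def K_zero digit_less d_pos)
  then show ?thesis by (simp only: entry_indexed prod_indicator)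
qed

lemma mor_id:
  assumes "x \<in> space n"
  shows "mor (tb_id n) x = x"
proof
  fix q
  have "(\<Sum>p<d ^ n. x p * entry (tb_id n) p q) = (\<Sum>p<d ^ n. if p = q then x q else 0)" if "q < d ^ n"
    unfolding tb_id_def entry_cylinders digits_eq_iff[OF d_pos]
    by (intro sum.cong refl) (use that in simp)
  then show "mor (tb_id n) x q = x q"
    using assms by (auto simp: mor_apply[OF tb_id_in_Tb] space_def coord_space_def)
qed

text \<open>
  The bordism \<open>W\<close> sees the low digits of both colourings, the shifted \<open>W'\<close> the high digits.
\<close>

lemma entry_disj:
  assumes "W \<in> Tb n m" "W' \<in> Tb n' m'"
  shows "entry (tb_disj n m W W') p q = entry W (p mod d ^ n) (q mod d ^ m) * entry W' (p div d ^ n) (q div d ^ m)"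
proof -
  let ?W = "{# Component (map_option (\<lambda>i. n + i) (in_circle c))
              (map_option (\<lambda>j. m + j) (out_circle c)) (genus c). c \<in># W' #}"
  have "entry W p q = entry W (p mod d ^ n) (q mod d ^ m)"
  proof (rule entry_cong)
    fix c assume c: "c \<in># W"
    have "i < n" if "in_circle c = Some i" for i
    proof -
      have "i \<in># in_circles W" using c that by (force simp: in_circles_def)
      then show ?thesis using assms(1) by (simp add: Tb_def)
    qed
    moreover have "j < m" if "out_circle c = Some j" for j
    proof -
      have "j \<in># out_circles W" using c that by (force simp: out_circles_def)
      then show ?thesis using assms(1) by (simp add: Tb_def)
    qed
    ultimately show "weight c p q = weight c (p mod d ^ n) (q mod d ^ m)"
      by (cases "in_circle c"; cases "out_circle c") (simp_all add: weight_def digit_mod)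
  qed
  moreover have "entry ?W p q = entry W' (p div d ^ n) (q div d ^ m)"
    unfolding entry_def multiset.map_comp
    by (rule arg_cong[of _ _ prod_mset], rule image_mset_cong)
       (simp add: weight_def option.map_comp digit_div[abs_def] o_def)
  ultimately show ?thesis by (simp add: tb_disj_def entry_add)
qed

lemma mor_natural:
  assumes W: "W \<in> Tb n m" and W': "W' \<in> Tb n' m'"
  shows "mor (tb_disj n m W W') (kron (d ^ n) x y) = kron (d ^ m) (mor W x) (mor W' y)"
proof
  fix q
  have "mor (tb_disj n m W W') (kron (d ^ n) x y) q = (if q < d ^ (m + m') then
     \<Sum>p<d ^ n * d ^ n'. kron (d ^ n) x y p * entry (tb_disj n m W W') p q else 0)"
    by (simp add: mor_apply[OF tb_disj_in_Tb[OF W W']] power_add)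
  also have "(\<Sum>p<d ^ n * d ^ n'. kron (d ^ n) x y p * entry (tb_disj n m W W') p q) =
    (\<Sum>j<d ^ n'. \<Sum>i<d ^ n. (x i * entry W i (q mod d ^ m)) * (y j * entry W' j (q div d ^ m)))"
    unfolding sum_mult_index entry_disj[OF W W'] by (intro sum.cong refl) (use d_pos in \<open>simp add: kron_def mult_ac\<close>)
  also have "\<dots> = (\<Sum>i<d ^ n. x i * entry W i (q mod d ^ m)) * (\<Sum>j<d ^ n'. y j * entry W' j (q div d ^ m))"
    by (subst sum.swap) (simp only: sum_product)
  also have "q < d ^ (m + m') \<longleftrightarrow> q div d ^ m < d ^ m'"
    using d_pos by (simp add: div_less_iff_less_mult power_add mult.commute)
  finally show "mor (tb_disj n m W W') (kron (d ^ n) x y) q = kron (d ^ m) (mor W x) (mor W' y) q"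
    using d_pos by (simp add: kron_def mor_apply[OF W] mor_apply[OF W'])
qed

lemma kron_assoc:
  "kron (d ^ (l + m)) (kron (d ^ l) x y) z = kron (d ^ l) x (kron (d ^ m) y z)"
proof
  fix i
  have "i mod d ^ (l + m) mod d ^ l = i mod d ^ l"
    by (simp add: power_add mod_mult2_eq)
  moreover have "i mod d ^ (l + m) div d ^ l = i div d ^ l mod d ^ m"
    using d_pos by (simp add: power_add mod_mult2_eq)
  moreover have "i div d ^ (l + m) = i div d ^ l div d ^ m"
    by (simp add: power_add div_mult2_eq)
  ultimately show "kron (d ^ (l + m)) (kron (d ^ l) x y) z i = kron (d ^ l) x (kron (d ^ m) y z) i"
    by (simp add: kron_def mult.assoc)
qed

lemma kron_unit_left: "kron (d ^ 0) (std_vec 0) x = x"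
  by (simp add: kron_def std_vec_def)

lemma kron_unit_right:
  assumes "x \<in> space n"
  shows "kron (d ^ n) x (std_vec 0) = x"
proof
  fix i
  show "kron (d ^ n) x (std_vec 0) i = x i"
  proof (cases "i < d ^ n")
    case True
    then show ?thesis by (simp add: kron_def std_vec_def)
  next
    case False
    then have "i div d ^ n \<noteq> 0" using d_pos by (simp add: div_eq_0_iff)
    then show ?thesis using False assms by (simp add: kron_def std_vec_def space_def coord_space_def)
  qed
qed

text \<open>
  The only entry in column \<open>q\<close> that does not vanish is at the number that arises from \<open>q\<close> by exchanging
  its low \<open>n\<close> digits with its high \<open>m\<close> digits.
\<close>

lemma mor_swap:
  assumes x: "x \<in> space m" and y: "y \<in> space n"
  shows "mor (tb_swap m n) (kron (d ^ m) x y) = kron (d ^ n) y x"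
proof
  fix q
  show "mor (tb_swap m n) (kron (d ^ m) x y) q = kron (d ^ n) y x q"
  proof (cases "q < d ^ (n + m)")
    case True
    then have q: "q div d ^ n < d ^ m"
      by (simp add: power_add mult.commute less_mult_imp_div_less)
    have e: "entry (tb_swap m n) (i + d ^ m * j) q = (if i = q div d ^ n \<and> j = q mod d ^ n then 1 else 0)"
      if "i < d ^ m" "j < d ^ n" for i j
    proof -
      have "(\<forall>t<m. digit d (i + d ^ m * j) t = digit d q (n + t)) \<longleftrightarrow> i = q div d ^ n"
        unfolding digit_div[symmetric] digits_eq_iff[OF d_pos] using that q by simp
      moreover have "(\<forall>t<n. digit d (i + d ^ m * j) (m + t) = digit d q t) \<longleftrightarrow> j = q mod d ^ n"
        unfolding digit_div[symmetric] digits_eq_iff[OF d_pos]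
        using that by (simp add: div_mult_self2 d_pos)
      ultimately show ?thesis
        by (simp add: tb_swap_def entry_add entry_cylinders)
    qed
    have "mor (tb_swap m n) (kron (d ^ m) x y) q =
        (\<Sum>p<d ^ m * d ^ n. kron (d ^ m) x y p * entry (tb_swap m n) p q)"
      using True by (simp add: mor_apply[OF tb_swap_in_Tb] power_add)
    also have "\<dots> = (\<Sum>j<d ^ n. \<Sum>i<d ^ m. if i = q div d ^ n then
        if j = q mod d ^ n then x (q div d ^ n) * y (q mod d ^ n) else 0 else 0)"
      unfolding sum_mult_index by (intro sum.cong refl) (use d_pos q in \<open>simp add: e kron_def\<close>)
    also have "\<dots> = x (q div d ^ n) * y (q mod d ^ n)"
      using q d_pos by simp
    finally show ?thesis by (simp add: kron_def)
  next
    case False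
    then have "q div d ^ n \<ge> d ^ m"
      using d_pos by (simp add: less_eq_div_iff_mult_less_eq power_add mult.commute not_less)
    then show ?thesis using False x
      by (simp add: mor_apply[OF tb_swap_in_Tb] kron_def space_def coord_space_def)
  qed
qed

theorem almost_TQFT_mor: "almost_TQFT space mor (\<lambda>m n. kron (d ^ m)) (std_vec 0)"
proof
  show "fd_space (space n)" for n unfolding space_def by (rule fd_space_coord_space)
  show "is_tensor_product (space m) (space n) (space (m + n)) (kron (d ^ m))" for m n
    unfolding space_def power_add using d_pos by (intro kron_is_tensor_product) simp
  show "std_vec 0 \<noteq> (0 :: nat \<Rightarrow> 'k)" by (auto simp: std_vec_def fun_eq_iff)
  have "{..<d ^ 0} = {0}" by auto
  then show "space 0 = seq.span {std_vec 0}" by (simp add: space_def coord_space_eq_span)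
qed (simp_all add: mor_linear mor_id mor_comp mor_natural kron_assoc kron_unit_left[simplified]
    kron_unit_right mor_swap)

lemma mor_closed_surface: "mor (closed_surface g) (std_vec 0) = seq_scale (K g None None) (std_vec 0)"
proof -
  have "closed_surface g \<in> Tb 0 0"
    by (simp add: Tb_def closed_surface_def in_circles_def out_circles_def)
  then show ?thesis
    by (simp add: fun_eq_iff mor_apply seq_scale_def std_vec_def closed_surface_def entry_def weight_def)
qed

lemma almost_quantizable_weights: "almost_quantizable (\<lambda>g. K g None None)"
  unfolding almost_quantizable_def using almost_TQFT_mor mor_closed_surface by blast

end

section \<open>From a recurrence to an almost-TQFT\<close>

text \<open>
  The fundamental solutions of the recurrence with coefficients \<open>c\<close>: the first \<open>d\<close> values are those
  of the \<open>a\<close>-th standard basis vector.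
\<close>

function rec_seq :: "nat \<Rightarrow> (nat \<Rightarrow> 'a::comm_ring_1) \<Rightarrow> nat \<Rightarrow> nat \<Rightarrow> 'a" where
  "rec_seq d c a n = (if n < d then if n = a then 1 else 0
     else \<Sum>i\<in>{..<d}. c i * rec_seq d c a (n - d + i))"
  by auto
termination by (relation "measure (\<lambda>(d, c, a, n). n)") auto

declare rec_seq.simps [simp del]

lemma rec_seq_init: "n < d \<Longrightarrow> rec_seq d c a n = (if n = a then 1 else 0)"
  by (simp add: rec_seq.simps)

lemma rec_seq_rec: "rec_seq d c a (n + d) = (\<Sum>i<d. c i * rec_seq d c a (n + i))"
  by (subst rec_seq.simps) simp

lemma recurrence_unique:
  assumes s: "\<And>n. s (n + d) = (\<Sum>i<d. c i * s (n + i))"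
    and t: "\<And>n. t (n + d) = (\<Sum>i<d. c i * t (n + i))"
    and init: "\<And>n::nat. n < d \<Longrightarrow> s n = t n"
  shows "s n = (t n :: 'a::comm_ring_1)"
proof (induction n rule: less_induct)
  case (less n)
  show ?case
  proof (cases "n < d")
    case False
    then have "s (n - d + d) = t (n - d + d)"
      unfolding s t by (intro sum.cong refl arg_cong2[where f = "(*)"] less.IH) auto
    then show ?thesis using False by simp
  qed (rule init)
qed

text \<open>
  The companion matrix of the recurrence acts on the state \<open>(s n, \<dots>, s (n + d - 1))\<close> of a solution by
  shifting \<open>n\<close>. So the entry of its \<open>g\<close>-th power from state \<open>a\<close> to coordinate \<open>b\<close> is the value at
  \<open>g + b\<close> of the \<open>a\<close>-th fundamental solution. Taking the initial state of \<open>\<chi>\<close> as the disc with empty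
  in-boundary and the coordinate \<open>0\<close> as the disc with empty out-boundary gives \<open>\<chi> g\<close> on the closed
  surface of genus \<open>g\<close>.
\<close>

lemma almost_quantizable_if_C_recurrent:
  fixes \<chi> :: "nat \<Rightarrow> 'k::field"
  assumes "C_recurrent \<chi>"
  shows "almost_quantizable \<chi>"
proof -
  from assms obtain d c where d: "d \<ge> 1" and \<chi>: "\<And>n. \<chi> (n + d) = (\<Sum>i<d. c i * \<chi> (n + i))"
    by (rule C_recurrent_pos_order) (rule that)
  define S where "S x = (case x of None \<Rightarrow> \<chi> | Some a \<Rightarrow> rec_seq d c a)" for x
  define off where "off y = (case y of None \<Rightarrow> 0::nat | Some b \<Rightarrow> b)" for y
  have S_rec: "S x (n + d) = (\<Sum>i<d. c i * S x (n + i))" for x n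
    by (cases x) (simp_all add: S_def \<chi> rec_seq_rec)
  \<comment> \<open>Both sides solve the recurrence in \<open>n\<close>, with the same initial values.\<close>
  have S_shift: "S x (g + n) = (\<Sum>b<d. S x (g + b) * rec_seq d c b n)" for x g n
  proof (rule recurrence_unique[where s = "\<lambda>n. S x (g + n)" and d = d and c = c])
    show "S x (g + (n + d)) = (\<Sum>i<d. c i * S x (g + (n + i)))" for n
      using S_rec[of x "g + n"] by (simp add: add.assoc)
    show "(\<Sum>b<d. S x (g + b) * rec_seq d c b (n + d)) =
        (\<Sum>i<d. c i * (\<Sum>b<d. S x (g + b) * rec_seq d c b (n + i)))" for n
      unfolding rec_seq_rec sum_distrib_left by (subst sum.swap) (simp only: mult.left_commute)
    show "S x (g + n) = (\<Sum>b<d. S x (g + b) * rec_seq d c b n)" if "n < d" for n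
    proof -
      have "(\<Sum>b<d. S x (g + b) * rec_seq d c b n) = (\<Sum>b<d. if b = n then S x (g + n) else 0)"
        by (intro sum.cong refl) (use that in \<open>auto simp: rec_seq_init\<close>)
      then show ?thesis using that by simp
    qed
  qed
  interpret tube_weights d "\<lambda>g x y. S x (g + off y)"
  proof
    show "d > 0" using d by simp
    show "S (Some a) (0 + off (Some b)) = (if a = b then 1 else 0)" if "b < d" for a b
      using that by (simp add: S_def off_def rec_seq_init)
    show "S x (g + h + off y) = (\<Sum>b<d. S x (g + off (Some b)) * S (Some b) (h + off y))" for x y g h
      using S_shift[of x g "h + off y"] by (simp add: S_def off_def add.assoc)
  qed
  show ?thesis using almost_quantizable_weights by (simp add: S_def off_def)
qed

section \<open>From an almost-TQFT to a recurrence\<close>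

text \<open>
  Otherwise the vectors would be distinct and independent, more of them than a finite spanning set
  has elements.
\<close>

lemma fd_family_dependent:
  fixes v :: "nat \<Rightarrow> nat \<Rightarrow> 'k::field"
  assumes "fd_space V" "\<And>n. v n \<in> V"
  shows "\<exists>d. v d \<in> seq.span (v ` {..<d})"
proof (rule ccontr)
  assume "\<not> ?thesis"
  then have new: "v d \<notin> seq.span (v ` {..<d})" for d by blast
  from assms(1) obtain B where B: "finite B" "V = seq.span B" unfolding fd_space_def by blast
  have "seq.independent (v ` {..<n}) \<and> card (v ` {..<n}) = n" for n
  proof (induction n)
    case 0
    show ?case by (simp add: seq.independent_empty)
  next
    case (Suc n)
    have "v n \<notin> v ` {..<n}" using new[of n] seq.span_base[of "v n" "v ` {..<n}"] by auto
    then show ?case using Suc.IH new[of n]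
      by (simp add: lessThan_Suc seq.independent_insert)
  qed
  moreover have "v ` {..<n} \<subseteq> seq.span B" for n using assms(2) B(2) by auto
  ultimately have "Suc (card B) \<le> card B"
    using seq.independent_span_bound[OF B(1)] by metis
  then show False by simp
qed

lemma span_image_lessThan:
  fixes v :: "nat \<Rightarrow> nat \<Rightarrow> 'k::field"
  assumes "x \<in> seq.span (v ` {..<d})"
  shows "\<exists>c. x = (\<Sum>i<d. seq_scale (c i) (v i))"
  using assms
proof (induction d arbitrary: x)
  case (Suc d)
  then obtain k where "x - seq_scale k (v d) \<in> seq.span (v ` {..<d})"
    by (auto simp: lessThan_Suc seq.span_insert)
  from Suc.IH[OF this] obtain c where c: "x - seq_scale k (v d) = (\<Sum>i<d. seq_scale (c i) (v i))" by blast
  have "(\<Sum>i<d. seq_scale ((c(d := k)) i) (v i)) = (\<Sum>i<d. seq_scale (c i) (v i))"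
    by (intro sum.cong refl) simp
  then have "x = (\<Sum>i<Suc d. seq_scale ((c(d := k)) i) (v i))"
    using c by (simp add: diff_eq_eq)
  then show ?case by blast
qed simp

text \<open>
  Cut the closed surface of genus \<open>g\<close> into a disc with all the handles, whose value is a vector \<open>v g\<close>
  in the space of one circle, and a cap. As that space is finite-dimensional, some \<open>v d\<close> is a
  combination of the earlier ones. Gluing a tube of genus \<open>n\<close> in between shifts this relation by \<open>n\<close>,
  and the cap turns it into a recurrence for \<open>\<chi>\<close>.
\<close>

lemma C_recurrent_if_almost_quantizable:
  fixes \<chi> :: "nat \<Rightarrow> 'k::field"
  assumes "almost_quantizable \<chi>"
  shows "C_recurrent \<chi>"
proof -
  from assms obtain Z0 Z \<mu> u where "almost_TQFT Z0 Z \<mu> u"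
    and \<chi>: "\<And>g. Z (closed_surface g) u = seq_scale (\<chi> g) u"
    unfolding almost_quantizable_def by blast
  then interpret almost_TQFT Z0 Z \<mu> u by simp
  define disc where "disc g = {# Component None (Some 0) g #}" for g
  define tube where "tube g = {# Component (Some 0) (Some 0) g #}" for g
  define cap where "cap = {# Component (Some 0) None 0 #}"
  note defs = disc_def tube_def cap_def closed_surface_def
  have Tb: "disc g \<in> Tb 0 1" "tube g \<in> Tb 1 1" "cap \<in> Tb 1 0" for g
    by (simp_all add: Tb_def defs in_circles_def out_circles_def lessThan_Suc)
  have comp: "tb_comp (disc g) (tube h) = disc (h + g)" "tb_comp (disc g) cap = closed_surface g" for g h
    by (simp_all add: tb_comp_def defs)
  have u: "u \<in> Z0 0" using unit_iso(2) seq.span_base by blast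
  define v where "v g = Z (disc g) u" for g
  have v: "v g \<in> Z0 1" for g
    unfolding v_def using Z_mor[OF Tb(1)] u unfolding linear_map_def by blast
  have v_add: "v (h + g) = Z (tube h) (v g)" for g h
    unfolding v_def comp(1)[symmetric] by (rule Z_comp[OF Tb(1) Tb(2) u])
  have v_cap: "Z cap (v g) = seq_scale (\<chi> g) u" for g
    unfolding v_def \<chi>[symmetric] comp(2)[symmetric] by (rule Z_comp[OF Tb(1) Tb(3) u, symmetric])
  obtain d where "v d \<in> seq.span (v ` {..<d})" using fd_family_dependent[of "Z0 1" v] Z_obj v by blast
  then obtain c where c: "v d = (\<Sum>i<d. seq_scale (c i) (v i))" using span_image_lessThan by blast
  have sub: "seq.subspace (Z0 1)" using Z_obj by (rule fd_space_subspace)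
  have "\<chi> (n + d) = (\<Sum>i<d. c i * \<chi> (n + i))" for n
  proof -
    have "seq_scale (\<chi> (n + d)) u = Z cap (Z (tube n) (\<Sum>i<d. seq_scale (c i) (v i)))"
      by (simp only: v_cap[symmetric] v_add c)
    also have "Z (tube n) (\<Sum>i<d. seq_scale (c i) (v i)) = (\<Sum>i<d. seq_scale (c i) (v (n + i)))"
      by (subst linear_map_lincomb[OF Z_mor[OF Tb(2)] sub v]) (simp only: v_add)
    also have "Z cap \<dots> = (\<Sum>i<d. seq_scale (c i) (seq_scale (\<chi> (n + i)) u))"
      by (subst linear_map_lincomb[OF Z_mor[OF Tb(3)] sub v]) (simp only: v_cap)
    also have "\<dots> = seq_scale (\<Sum>i<d. c i * \<chi> (n + i)) u"
      by (simp only: seq.scale_scale seq.scale_sum_left)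
    finally show ?thesis using unit_iso(1) by (simp add: seq.scale_cancel_right)
  qed
  then show ?thesis unfolding C_recurrent_def by (intro exI[of _ d] exI[of _ c]) simp
qed

section \<open>Almost-quantizable invariants\<close>

theorem theorem3p14:
  fixes \<chi> :: "nat \<Rightarrow> 'k::field"
  assumes non_constant: "\<not> (\<exists>c. \<forall>g. \<chi> g = c)"
  shows "almost_quantizable \<chi> \<longleftrightarrow>
    (\<exists>(N::nat) ms (lam :: nat \<Rightarrow> 'k alg_closure) (a :: nat \<Rightarrow> nat \<Rightarrow> 'k alg_closure).
       N \<ge> 1 \<and> is_partition N ms \<and>
       (\<forall>g \<ge> Max (set ms).
          to_ac (\<chi> g) =
            (\<Sum>i<length ms. \<Sum>j<ms ! i. a i j * of_nat (g choose j) * lam i ^ (g - j))))"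
  unfolding C_recurrent_iff_jordan_sum[of "\<lambda>g. to_ac (\<chi> g)", symmetric] C_recurrent_to_ac_iff
  using almost_quantizable_if_C_recurrent C_recurrent_if_almost_quantizable by blast

end
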